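(* Let $X_1,X_2,X_3$ be diffeological spaces, let $Y\subseteq X_1$, $W_1,W_2\subseteq X_3$, let $f:Y\to X_2$ be a subduction, let $h_i:W_i\to X_i$, $i=1,2$, be smooth, and let $\bar{h}_i=\alpha_i\circ h_i:W_i\to X_1\cup_fX_2$. If $f,h_1$ are such that $\mathcal{D}_f^{i^*}(Y)=\mathcal{D}^{f^*j^*}(Y)$ and $\mathcal{D}_{h_1,f}^{k_1^*}(W_1)=\mathcal{D}_f^{h_1^*l_1^*}(W_1)$, then $\mathcal{D}_{\bar{h}_1}^{k_1^*}(W_1)=\mathcal{D}^{\bar{h}_1^*\bar{l}_1^*}(W_1)$. Likewise, if $f,h_2$ are such that $\mathcal{D}_f^{i^*}(Y)=\mathcal{D}^{f^*j^*}(Y)$ and $\mathcal{D}_{h_2}^{k_2^*}(W_2)=\mathcal{D}^{h_2^*l_2^*}(W_2)$, then $\mathcal{D}_{\bar{h}_2}^{k_2^*}(W_2)=\mathcal{D}^{\bar{h}_2^*\bar{l}_2^*}(W_2)$.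
   Context: A diffeology on a set $X$ is a set of maps (plots) $p:U\to X$, with $U$ a domain (open set) in some $\mathbb{R}^n$ ($n$ varying), that contains all constant maps, is closed under precomposition with ordinary smooth maps between domains, and contains every map that is locally a plot. A map between diffeological spaces is smooth if its composition with every plot is a plot. A smooth map $f:A\to B$ is a subduction if every plot of $B$ locally has the form $f\circ p$ for some plot $p$ of $A$. The pushforward of the diffeology of $A$ by a map $h:A\to B$ is the finest diffeology on $B$ for which $h$ is smooth. Subsets carry the subset diffeology, disjoint unions the finest diffeology making the inclusions smooth, quotients the finest making the projection smooth. Let $m\geqslant 0$ be a fixed integer. A differential $m$-form $\omega$ on $X$ assigns to each plot $p:U\to X$ an ordinary smooth $m$-form $\omega(p)$ on $U$ such that $\omega(p\circ F)=F^*(\omega(p))$ for every smooth $F:U'\to U$. For smooth $g:A\to B$, $(g^*\omega)(p)=\omega(g\circ p)$. $\Omega^m(X)$ is the vector space of all $m$-forms on $X$ with the functional diffeology: $Q:U'\to\Omega^m(X)$ is a plot iff for every plot $p:U\to X$, $U\subseteq\mathbb{R}^n$, the map $(u',u)\mapsto Q(u')(p)(u)\in\Lambda^m(\mathbb{R}^n)$ is smooth on $U'\times U$. Subspaces carry the subset diffeology. $X_1\cup_f X_2=(X_1\sqcup X_2)/\!\sim$, with $\sim$ generated by $y\sim f(y)$, $y\in Y$, and the quotient diffeology; $\alpha_k:X_k\hookrightarrow X_1\sqcup X_2\to X_1\cup_fX_2$ ($k=1,2$). Inclusions: $i:Y\hookrightarrow X_1$, $j:f(Y)\hookrightarrow X_2$,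 and for $n=1,2$: $k_n:W_n\hookrightarrow X_3$, $l_n:h_n(W_n)\hookrightarrow X_n$, $\bar l_n:\bar h_n(W_n)\hookrightarrow X_1\cup_fX_2$. In $f^*j^*$, $h_n^*l_n^*$, $\bar h_n^*\bar l_n^*$ the maps $f,h_n,\bar h_n$ are regarded as maps onto their images. For a map $g$ defined on a subset $S$ of a diffeological space $X$, two plots $p,p'$ of $X$ with the same domain $U$ are $g$-equivalent if for all $u\in U$ with $p(u)\neq p'(u)$ we have $p(u),p'(u)\in S$ and $g(p(u))=g(p'(u))$; a form is $g$-invariant if it takes equal values on any two $g$-equivalent plots; $\Omega_g^m(X)\leqslant\Omega^m(X)$ is the subspace of $g$-invariant forms. (This is used for $\Omega_f^m(X_1)$, $\Omega_{h_2}^m(X_3)$, $\Omega_{\bar h_n}^m(X_3)$.) Two plots $p_3,p_3':U\to X_3$ are $(h_1,f)$-equivalent if for all $u$ such that $p_3(u)\neq p_3'(u)$ we have $p_3(u),p_3'(u)\in W_1$ and either $h_1(p_3(u))=h_1(p_3'(u))$, or $h_1(p_3(u)),h_1(p_3'(u))\in Y$ and $f(h_1(p_3(u)))=f(h_1(p_3'(u)))$; $\Omega_{h_1,f}^m(X_3)$ is the subspace of forms taking equal values on any two $(h_1,f)$-equivalent plots. The diffeologies are the following pushforwards. On $\Omega^m(Y)$: $\mathcal{D}_f^{i^*}(Y)$ is the pushforward of the diffeology of $\Omega_f^m(X_1)$ by $i^*$, and $\mathcal{D}^{f^*j^*}(Y)$ that of $\Omega^m(X_2)$ by $f^*j^*$.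 On $\Omega^m(W_1)$: $\mathcal{D}_{h_1,f}^{k_1^*}(W_1)$ is that of $\Omega_{h_1,f}^m(X_3)$ by $k_1^*$; $\mathcal{D}_f^{h_1^*l_1^*}(W_1)$ that of $\Omega_f^m(X_1)$ by $h_1^*l_1^*$; $\mathcal{D}_{\bar h_1}^{k_1^*}(W_1)$ that of $\Omega_{\bar h_1}^m(X_3)$ by $k_1^*$; $\mathcal{D}^{\bar h_1^*\bar l_1^*}(W_1)$ that of $\Omega^m(X_1\cup_fX_2)$ by $\bar h_1^*\bar l_1^*$. On $\Omega^m(W_2)$: $\mathcal{D}_{h_2}^{k_2^*}(W_2)$ is that of $\Omega_{h_2}^m(X_3)$ by $k_2^*$; $\mathcal{D}^{h_2^*l_2^*}(W_2)$ that of $\Omega^m(X_2)$ by $h_2^*l_2^*$; $\mathcal{D}_{\bar h_2}^{k_2^*}(W_2)$ that of $\Omega_{\bar h_2}^m(X_3)$ by $k_2^*$; $\mathcal{D}^{\bar h_2^*\bar l_2^*}(W_2)$ that of $\Omega^m(X_1\cup_fX_2)$ by $\bar h_2^*\bar l_2^*$. *)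

theory Defs
  imports "HOL-Analysis.Analysis"
begin

section \<open>Smooth functions on domains\<close>

text \<open>
  Plots have domains in \<open>\<real>\<^sup>n\<close> for varying \<open>n\<close>, so the spaces \<open>\<real>\<^sup>n\<close> have to live in one type.  As in
  \<^const>\<open>Euclidean_space\<close>, a point of \<open>\<real>\<^sup>n\<close> is a function \<open>x :: nat \<Rightarrow> real\<close> with \<open>x i = 0\<close> for
  \<open>i \<ge> n\<close>; the coordinates are \<open>x 0, \<dots>, x (n - 1)\<close>.
\<close>

abbreviation Rn :: "nat \<Rightarrow> (nat \<Rightarrow> real) set"
  where "Rn n \<equiv> topspace (Euclidean_space n)"

abbreviation domain :: "nat \<Rightarrow> (nat \<Rightarrow> real) set \<Rightarrow> bool"
  where "domain n U \<equiv> openin (Euclidean_space n) U"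

definition partial_deriv :: "nat \<Rightarrow> ((nat \<Rightarrow> real) \<Rightarrow> real) \<Rightarrow> (nat \<Rightarrow> real) \<Rightarrow> real"
  where "partial_deriv i g x = deriv (\<lambda>t. g (x(i := t))) (x i)"

text \<open>\<open>Ck k n U g\<close>: all partial derivatives of \<open>g\<close> of order at most \<open>k\<close> exist and are continuous
  on the domain \<open>U\<close> of \<open>\<real>\<^sup>n\<close>.\<close>

fun Ck :: "nat \<Rightarrow> nat \<Rightarrow> (nat \<Rightarrow> real) set \<Rightarrow> ((nat \<Rightarrow> real) \<Rightarrow> real) \<Rightarrow> bool" where
  "Ck 0 n U g \<longleftrightarrow> continuous_map (subtopology (Euclidean_space n) U) euclideanreal g"
| "Ck (Suc k) n U g \<longleftrightarrow>
     continuous_map (subtopology (Euclidean_space n) U) euclideanreal g \<and>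
     (\<forall>i<n. (\<forall>x\<in>U. (\<lambda>t. g (x(i := t))) field_differentiable at (x i)) \<and>
            Ck k n U (partial_deriv i g))"

definition smooth_fun :: "nat \<Rightarrow> (nat \<Rightarrow> real) set \<Rightarrow> ((nat \<Rightarrow> real) \<Rightarrow> real) \<Rightarrow> bool"
  where "smooth_fun n U g \<longleftrightarrow> (\<forall>k. Ck k n U g)"

text \<open>Ordinary smooth maps from \<open>U' \<subseteq> \<real>\<^sup>n'\<close> to \<open>U \<subseteq> \<real>\<^sup>n\<close>.\<close>

definition smooth_between ::
  "nat \<Rightarrow> (nat \<Rightarrow> real) set \<Rightarrow> nat \<Rightarrow> (nat \<Rightarrow> real) set \<Rightarrow> ((nat \<Rightarrow> real) \<Rightarrow> nat \<Rightarrow> real) \<Rightarrow> bool"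
  where "smooth_between n' U' n U F \<longleftrightarrow>
    domain n' U' \<and> domain n U \<and> F \<in> U' \<rightarrow> U \<and> (\<forall>j<n. smooth_fun n' U' (\<lambda>x. F x j))"


section \<open>Diffeologies\<close>

text \<open>
  A plot \<open>p : U \<rightarrow> X\<close> with \<open>U \<subseteq> \<real>\<^sup>n\<close> is the triple \<open>(n, U, p)\<close>, where \<open>p\<close> is extensional, i.e.
  \<^const>\<open>undefined\<close> outside \<open>U\<close>, so that plots are equal iff they agree on their common domain.
\<close>

type_synonym 'a plot = "nat \<times> (nat \<Rightarrow> real) set \<times> ((nat \<Rightarrow> real) \<Rightarrow> 'a)"

definition diffeology_on :: "'a set \<Rightarrow> 'a plot set \<Rightarrow> bool"
  where "diffeology_on X D \<longleftrightarrow>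
    (\<forall>(n, U, p) \<in> D. domain n U \<and> p \<in> U \<rightarrow>\<^sub>E X) \<and>
    (\<forall>n U x. domain n U \<longrightarrow> x \<in> X \<longrightarrow> (n, U, \<lambda>u\<in>U. x) \<in> D) \<and>
    (\<forall>(n, U, p) \<in> D. \<forall>n' U' F. smooth_between n' U' n U F \<longrightarrow> (n', U', compose U' p F) \<in> D) \<and>
    (\<forall>n U p. domain n U \<longrightarrow> p \<in> U \<rightarrow>\<^sub>E X \<longrightarrow>
       (\<forall>u\<in>U. \<exists>V. domain n V \<and> u \<in> V \<and> V \<subseteq> U \<and> (n, V, restrict p V) \<in> D) \<longrightarrow> (n, U, p) \<in> D)"

definition diff_smooth :: "'a set \<Rightarrow> 'a plot set \<Rightarrow> 'b set \<Rightarrow> 'b plot set \<Rightarrow> ('a \<Rightarrow> 'b) \<Rightarrow> bool"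
  where "diff_smooth A DA B DB f \<longleftrightarrow>
    f \<in> A \<rightarrow> B \<and> (\<forall>(n, U, p) \<in> DA. (n, U, compose U f p) \<in> DB)"

definition subduction :: "'a set \<Rightarrow> 'a plot set \<Rightarrow> 'b set \<Rightarrow> 'b plot set \<Rightarrow> ('a \<Rightarrow> 'b) \<Rightarrow> bool"
  where "subduction A DA B DB f \<longleftrightarrow>
    diff_smooth A DA B DB f \<and>
    (\<forall>(n, U, p) \<in> DB. \<forall>u\<in>U. \<exists>V q. domain n V \<and> u \<in> V \<and> V \<subseteq> U \<and>
       (n, V, q) \<in> DA \<and> restrict p V = compose V f q)"

definition sub_diff :: "'a set \<Rightarrow> 'a plot set \<Rightarrow> 'a plot set"
  where "sub_diff S D = {(n, U, p) \<in> D. p ` U \<subseteq> S}"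

text \<open>A finer diffeology has fewer plots and intersections of diffeologies are diffeologies, so the
  finest diffeology with a property that is stable under intersection is the intersection of all
  of them.\<close>

definition pushforward :: "'a set \<Rightarrow> 'a plot set \<Rightarrow> 'b set \<Rightarrow> ('a \<Rightarrow> 'b) \<Rightarrow> 'b plot set"
  where "pushforward A DA B h = \<Inter>{DB. diffeology_on B DB \<and> diff_smooth A DA B DB h}"

definition sum_diff ::
  "'a set \<Rightarrow> 'a plot set \<Rightarrow> 'b set \<Rightarrow> 'b plot set \<Rightarrow> ('a + 'b) plot set"
  where "sum_diff A DA B DB =
    \<Inter>{D. diffeology_on (A <+> B) D \<and>
        diff_smooth A DA (A <+> B) D Inl \<and> diff_smooth B DB (A <+> B) D Inr}"

definition quotient_diff :: "'a set \<Rightarrow> 'a plot set \<Rightarrow> ('a \<times> 'a) set \<Rightarrow> 'a set plot set"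
  where "quotient_diff A D R = pushforward A D (A // R) (\<lambda>x. R `` {x})"


section \<open>Gluing\<close>

definition glue_rel :: "'a set \<Rightarrow> 'b set \<Rightarrow> 'a set \<Rightarrow> ('a \<Rightarrow> 'b) \<Rightarrow> (('a + 'b) \<times> ('a + 'b)) set"
  where "glue_rel X1 X2 Y f =
    \<Inter>{R. equiv (X1 <+> X2) R \<and> (\<forall>y\<in>Y. (Inl y, Inr (f y)) \<in> R)}"

definition glue_diff ::
  "'a set \<Rightarrow> 'a plot set \<Rightarrow> 'b set \<Rightarrow> 'b plot set \<Rightarrow> 'a set \<Rightarrow> ('a \<Rightarrow> 'b) \<Rightarrow> ('a + 'b) set plot set"
  where "glue_diff X1 D1 X2 D2 Y f =
    quotient_diff (X1 <+> X2) (sum_diff X1 D1 X2 D2) (glue_rel X1 X2 Y f)"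

definition glue_inl :: "'a set \<Rightarrow> 'b set \<Rightarrow> 'a set \<Rightarrow> ('a \<Rightarrow> 'b) \<Rightarrow> 'a \<Rightarrow> ('a + 'b) set"
  where "glue_inl X1 X2 Y f x = glue_rel X1 X2 Y f `` {Inl x}"

definition glue_inr :: "'a set \<Rightarrow> 'b set \<Rightarrow> 'a set \<Rightarrow> ('a \<Rightarrow> 'b) \<Rightarrow> 'b \<Rightarrow> ('a + 'b) set"
  where "glue_inr X1 X2 Y f x = glue_rel X1 X2 Y f `` {Inr x}"


section \<open>Differential forms\<close>

text \<open>\<open>\<Lambda>\<^sup>m(\<real>\<^sup>n)\<close> consists of the alternating \<open>m\<close>-linear forms on \<open>\<real>\<^sup>n\<close>, as functions of the list of
  their \<open>m\<close> arguments.  Here and below, a form is given the value \<open>0\<close> on irrelevant arguments, so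
  that equality of forms is equality of functions.\<close>

definition tuples :: "nat \<Rightarrow> nat \<Rightarrow> (nat \<Rightarrow> real) list set"
  where "tuples m n = {vs. length vs = m \<and> set vs \<subseteq> Rn n}"

definition alt_forms :: "nat \<Rightarrow> nat \<Rightarrow> ((nat \<Rightarrow> real) list \<Rightarrow> real) set"
  where "alt_forms m n = {A.
    (\<forall>vs. vs \<notin> tuples m n \<longrightarrow> A vs = 0) \<and>
    (\<forall>vs \<in> tuples m n. \<forall>i<m. \<forall>x \<in> Rn n. \<forall>y \<in> Rn n. \<forall>a b.
       A (vs[i := (\<lambda>k. a * x k + b * y k)]) = a * A (vs[i := x]) + b * A (vs[i := y])) \<and>
    (\<forall>vs \<in> tuples m n. \<forall>i<m. \<forall>j<m. i \<noteq> j \<longrightarrow> vs ! i = vs ! j \<longrightarrow> A vs = 0)}"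

text \<open>Since \<open>\<Lambda>\<^sup>m(\<real>\<^sup>n)\<close> is finite-dimensional with the evaluations at tuples of vectors spanning its
  dual, a map into it is smooth iff all its evaluations are.\<close>

definition smooth_into_alt ::
  "nat \<Rightarrow> nat \<Rightarrow> nat \<Rightarrow> (nat \<Rightarrow> real) set \<Rightarrow> ((nat \<Rightarrow> real) \<Rightarrow> (nat \<Rightarrow> real) list \<Rightarrow> real) \<Rightarrow> bool"
  where "smooth_into_alt m n d U \<eta> \<longleftrightarrow>
    (\<forall>u\<in>U. \<eta> u \<in> alt_forms m n) \<and> (\<forall>vs \<in> tuples m n. smooth_fun d U (\<lambda>u. \<eta> u vs))"

definition ordinary_form ::
  "nat \<Rightarrow> nat \<Rightarrow> (nat \<Rightarrow> real) set \<Rightarrow> ((nat \<Rightarrow> real) \<Rightarrow> (nat \<Rightarrow> real) list \<Rightarrow> real) \<Rightarrow> bool"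
  where "ordinary_form m n U \<eta> \<longleftrightarrow>
    smooth_into_alt m n n U \<eta> \<and> (\<forall>u. u \<notin> U \<longrightarrow> \<eta> u = (\<lambda>vs. 0))"

definition differential ::
  "nat \<Rightarrow> nat \<Rightarrow> ((nat \<Rightarrow> real) \<Rightarrow> nat \<Rightarrow> real) \<Rightarrow> (nat \<Rightarrow> real) \<Rightarrow> (nat \<Rightarrow> real) \<Rightarrow> nat \<Rightarrow> real"
  where "differential n' n F u v =
    (\<lambda>j. if j < n then (\<Sum>i<n'. partial_deriv i (\<lambda>x. F x j) u * v i) else 0)"

definition ordinary_pullback ::
  "nat \<Rightarrow> nat \<Rightarrow> (nat \<Rightarrow> real) set \<Rightarrow> nat \<Rightarrow> ((nat \<Rightarrow> real) \<Rightarrow> nat \<Rightarrow> real) \<Rightarrow>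
   ((nat \<Rightarrow> real) \<Rightarrow> (nat \<Rightarrow> real) list \<Rightarrow> real) \<Rightarrow> (nat \<Rightarrow> real) \<Rightarrow> (nat \<Rightarrow> real) list \<Rightarrow> real"
  where "ordinary_pullback m n' U' n F \<eta> u vs =
    (if u \<in> U' \<and> vs \<in> tuples m n' then \<eta> (F u) (map (differential n' n F u) vs) else 0)"

type_synonym 'a form = "'a plot \<Rightarrow> (nat \<Rightarrow> real) \<Rightarrow> (nat \<Rightarrow> real) list \<Rightarrow> real"

text \<open>\<open>\<Omega>\<^sup>m(X)\<close>, where \<open>D\<close> is the diffeology of \<open>X\<close>.\<close>

definition forms :: "nat \<Rightarrow> 'a plot set \<Rightarrow> 'a form set"
  where "forms m D = {\<omega>.
    (\<forall>P. P \<notin> D \<longrightarrow> \<omega> P = (\<lambda>u vs. 0)) \<and>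
    (\<forall>(n, U, p) \<in> D. ordinary_form m n U (\<omega> (n, U, p))) \<and>
    (\<forall>(n, U, p) \<in> D. \<forall>n' U' F. smooth_between n' U' n U F \<longrightarrow>
       \<omega> (n', U', compose U' p F) = ordinary_pullback m n' U' n F (\<omega> (n, U, p)))}"

text \<open>\<open>g\<^sup>*\<close> for a smooth map \<open>g\<close> from a space with diffeology \<open>DA\<close>.\<close>

definition form_pullback :: "'a plot set \<Rightarrow> ('a \<Rightarrow> 'b) \<Rightarrow> 'b form \<Rightarrow> 'a form"
  where "form_pullback DA g \<omega> =
    (\<lambda>(n, U, p). if (n, U, p) \<in> DA then \<omega> (n, U, compose U g p) else (\<lambda>u vs. 0))"

text \<open>For \<open>U' \<subseteq> \<real>\<^sup>k\<close> and \<open>U \<subseteq> \<real>\<^sup>n\<close>, the product \<open>U' \<times> U\<close> as a domain of \<open>\<real>\<^bsup>k+n\<^esup>\<close>.\<close>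

definition fst_part :: "nat \<Rightarrow> (nat \<Rightarrow> real) \<Rightarrow> nat \<Rightarrow> real"
  where "fst_part k w = (\<lambda>i. if i < k then w i else 0)"

definition snd_part :: "nat \<Rightarrow> (nat \<Rightarrow> real) \<Rightarrow> nat \<Rightarrow> real"
  where "snd_part k w = (\<lambda>i. w (k + i))"

definition prod_domain ::
  "nat \<Rightarrow> nat \<Rightarrow> (nat \<Rightarrow> real) set \<Rightarrow> (nat \<Rightarrow> real) set \<Rightarrow> (nat \<Rightarrow> real) set"
  where "prod_domain k n U' U = {w \<in> Rn (k + n). fst_part k w \<in> U' \<and> snd_part k w \<in> U}"

definition form_diff :: "nat \<Rightarrow> 'a plot set \<Rightarrow> 'a form plot set"
  where "form_diff m D = {(k, U', Q). domain k U' \<and> Q \<in> U' \<rightarrow>\<^sub>E forms m D \<and>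
    (\<forall>(n, U, p) \<in> D. smooth_into_alt m n (k + n) (prod_domain k n U' U)
       (\<lambda>w. Q (fst_part k w) (n, U, p) (snd_part k w)))}"


section \<open>Invariant forms\<close>

text \<open>Both notions of equivalence of plots used here require a relation \<open>E\<close> of the values
  wherever they differ.\<close>

definition plots_equivalent :: "('a \<Rightarrow> 'a \<Rightarrow> bool) \<Rightarrow> 'a plot \<Rightarrow> 'a plot \<Rightarrow> bool"
  where "plots_equivalent E P P' \<longleftrightarrow> (\<exists>n U p p'. P = (n, U, p) \<and> P' = (n, U, p') \<and>
    (\<forall>u\<in>U. p u \<noteq> p' u \<longrightarrow> E (p u) (p' u)))"

definition forms_inv_wrt :: "nat \<Rightarrow> 'a plot set \<Rightarrow> ('a \<Rightarrow> 'a \<Rightarrow> bool) \<Rightarrow> 'a form set"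
  where "forms_inv_wrt m D E =
    {\<omega> \<in> forms m D. \<forall>P\<in>D. \<forall>P'\<in>D. plots_equivalent E P P' \<longrightarrow> \<omega> P = \<omega> P'}"

text \<open>\<open>\<Omega>\<^sub>g\<^sup>m(X)\<close> for a map \<open>g\<close> defined on \<open>S \<subseteq> X\<close>.\<close>

definition inv_forms :: "nat \<Rightarrow> 'a plot set \<Rightarrow> 'a set \<Rightarrow> ('a \<Rightarrow> 'b) \<Rightarrow> 'a form set"
  where "inv_forms m D S g = forms_inv_wrt m D (\<lambda>x x'. x \<in> S \<and> x' \<in> S \<and> g x = g x')"

text \<open>\<open>\<Omega>\<^bsub>h,f\<^esub>\<^sup>m(X)\<close> for maps \<open>h\<close> defined on \<open>W \<subseteq> X\<close> and \<open>f\<close> defined on \<open>Y\<close>.\<close>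

definition inv_forms2 ::
  "nat \<Rightarrow> 'a plot set \<Rightarrow> 'a set \<Rightarrow> ('a \<Rightarrow> 'b) \<Rightarrow> 'b set \<Rightarrow> ('b \<Rightarrow> 'c) \<Rightarrow> 'a form set"
  where "inv_forms2 m D W h Y f = forms_inv_wrt m D
    (\<lambda>x x'. x \<in> W \<and> x' \<in> W \<and>
       (h x = h x' \<or> h x \<in> Y \<and> h x' \<in> Y \<and> f (h x) = f (h x')))"


section \<open>The pushforward diffeologies\<close>

text \<open>The pushforward to \<open>\<Omega>\<^sup>m(S)\<close> of the diffeology of a subspace \<open>\<Omega>'\<close> of \<open>\<Omega>\<^sup>m(X)\<close>, with \<open>D\<close> the
  diffeology of \<open>X\<close>, by \<open>i\<^sup>*\<close> for the inclusion \<open>i\<close> of \<open>S \<subseteq> X\<close>.\<close>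

definition restriction_diff :: "nat \<Rightarrow> 'a plot set \<Rightarrow> 'a form set \<Rightarrow> 'a set \<Rightarrow> 'a form plot set"
  where "restriction_diff m D \<Omega>' S =
    pushforward \<Omega>' (sub_diff \<Omega>' (form_diff m D)) (forms m (sub_diff S D))
      (form_pullback (sub_diff S D) (\<lambda>x. x))"

text \<open>For a map \<open>h\<close> from the subset \<open>S\<close> of a space with diffeology \<open>D\<close> to a space \<open>Z\<close> with
  diffeology \<open>DZ\<close>: the pushforward to \<open>\<Omega>\<^sup>m(S)\<close> of the diffeology of a subspace \<open>\<Omega>'\<close> of \<open>\<Omega>\<^sup>m(Z)\<close>
  by \<open>h\<^sup>*l\<^sup>*\<close>, where \<open>l\<close> is the inclusion of \<open>h(S)\<close> in \<open>Z\<close>.\<close>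

definition image_diff ::
  "nat \<Rightarrow> 'a plot set \<Rightarrow> 'a set \<Rightarrow> ('a \<Rightarrow> 'b) \<Rightarrow> 'b plot set \<Rightarrow> 'b form set \<Rightarrow> 'a form plot set"
  where "image_diff m D S h DZ \<Omega>' =
    pushforward \<Omega>' (sub_diff \<Omega>' (form_diff m DZ)) (forms m (sub_diff S D))
      (form_pullback (sub_diff S D) h \<circ> form_pullback (sub_diff (h ` S) DZ) (\<lambda>x. x))"

end

theory Submission
  imports Defs
begin

text \<open>
  Since \<open>f\<close> is a subduction onto \<open>X\<^sub>2\<close>, every plot of \<open>X\<^sub>1 \<union>\<^sub>f X\<^sub>2\<close> lifts locally to \<open>X\<^sub>1\<close>, so
  \<open>\<alpha>\<^sub>1\<close> is a subduction and \<open>\<alpha>\<^sub>1\<^sup>*\<close> is a diffeomorphism from \<open>\<Omega>\<^sup>m(X\<^sub>1 \<union>\<^sub>f X\<^sub>2)\<close> onto the forms on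
  \<open>X\<^sub>1\<close> that only depend on the plot modulo \<open>\<alpha>\<^sub>1\<close>, which are the \<open>f\<close>-invariant ones.  As
  \<open>(\<alpha>\<^sub>1 \<circ> h\<^sub>1)\<^sup>* = h\<^sub>1\<^sup>* \<alpha>\<^sub>1\<^sup>*\<close>, this identifies the two sides of the first claim with those of
  its hypothesis on \<open>W\<^sub>1\<close>.

  For the second claim, let \<open>Q\<close> be a plot of \<open>\<Omega>\<^sup>m(X\<^sub>2)\<close>.  By the hypothesis on \<open>Y\<close>, \<open>f\<^sup>*Q\<close> is locally
  constant or locally \<open>i\<^sup>*P\<close> with a plot \<open>P\<close> of \<open>f\<close>-invariant forms, and \<open>P = \<alpha>\<^sub>1\<^sup>*R\<close>, whence
  \<open>f\<^sup>*Q = f\<^sup>*\<alpha>\<^sub>2\<^sup>*R\<close>.  As \<open>f\<^sup>*\<close> is injective, \<open>Q\<close> is locally constant or \<open>\<alpha>\<^sub>2\<^sup>*R\<close>; either way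
  \<open>h\<^sub>2\<^sup>*Q\<close> is a plot for every diffeology that makes \<open>(\<alpha>\<^sub>2 \<circ> h\<^sub>2)\<^sup>*\<close> smooth.
\<close>

section \<open>Locality of smoothness\<close>

text \<open>On \<open>Rn n\<close> the coordinates from \<open>n\<close> on vanish, so they are
  trivially continuous; the topology is induced from the product, where continuity is
  coordinatewise.\<close>

lemma continuous_map_into_Rn:
  assumes "\<And>x. x \<in> topspace X \<Longrightarrow> F x \<in> Rn n"
    and "\<And>j. j < n \<Longrightarrow> continuous_map X euclideanreal (\<lambda>x. F x j)"
  shows "continuous_map X (Euclidean_space n) F"
proof -
  have "continuous_map X euclideanreal (\<lambda>x. F x j)" for j
  proof (cases "j < n")
    case False
    then have "F x j = 0" if "x \<in> topspace X" for x
      using assms(1)[OF that] by (simp add: topspace_Euclidean_space)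
    then show ?thesis
      using continuous_map_eq[of X euclideanreal "\<lambda>x. 0" "\<lambda>x. F x j"] by simp
  qed (use assms in auto)
  then show ?thesis
    using assms(1) unfolding Euclidean_space_def continuous_map_in_subtopology
    by (auto simp: continuous_map_componentwise_UNIV)
qed

lemma continuous_map_Rn_coordinate:
  "continuous_map (Euclidean_space n) euclideanreal (\<lambda>x. x j)"
  unfolding Euclidean_space_def
  by (intro continuous_map_from_subtopology continuous_map_product_coordinates) auto

lemma eventually_fun_upd_in_domain:
  assumes "domain n U" and "x \<in> U" and "i < n"
  shows "\<forall>\<^sub>F t in nhds (x i). x(i := t) \<in> U"
proof -
  have x: "x \<in> Rn n"
    using assms openin_subset by blast
  have "continuous_map euclideanreal (Euclidean_space n) (\<lambda>t. x(i := t))"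
    by (rule continuous_map_into_Rn)
      (use x assms in \<open>auto simp: topspace_Euclidean_space\<close>)
  from openin_continuous_map_preimage[OF this assms(1)]
  have "open {t. x(i := t) \<in> U}"
    by simp
  then show ?thesis
    using assms(2) unfolding eventually_nhds by (intro exI[of _ "{t. x(i := t) \<in> U}"]) auto
qed

text \<open>A partial derivative looks only along a coordinate line near the point, and that part of
  the line lies in \<open>U\<close>. HOL functions are total, so functions that agree merely on
  \<open>U\<close> need this comparison.\<close>

lemma partial_deriv_cong:
  assumes "domain n U" and "x \<in> U" and "i < n" and "\<And>y. y \<in> U \<Longrightarrow> g y = g' y"
  shows "partial_deriv i g x = partial_deriv i g' x"
    and "(\<lambda>t. g (x(i := t))) field_differentiable at (x i) \<longleftrightarrow>
         (\<lambda>t. g' (x(i := t))) field_differentiable at (x i)"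
proof -
  have ev: "\<forall>\<^sub>F t in nhds (x i). g (x(i := t)) = g' (x(i := t))"
    using eventually_fun_upd_in_domain[OF assms(1-3)] by eventually_elim (rule assms(4))
  then show "partial_deriv i g x = partial_deriv i g' x"
    unfolding partial_deriv_def by (rule deriv_cong_ev) simp
  show "(\<lambda>t. g (x(i := t))) field_differentiable at (x i) \<longleftrightarrow>
         (\<lambda>t. g' (x(i := t))) field_differentiable at (x i)"
    unfolding field_differentiable_def using DERIV_cong_ev[OF refl ev refl] by simp
qed

lemma partial_deriv_coordinate: "partial_deriv i (\<lambda>x. x j) u = (if i = j then 1 else 0)"
  by (simp add: partial_deriv_def)

lemma Ck_const: "Ck k n U (\<lambda>x. c)"
proof (induction k arbitrary: c)
  case (Suc k)
  have "partial_deriv i (\<lambda>x. c) = (\<lambda>x. 0)" for i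
    by (simp add: partial_deriv_def fun_eq_iff)
  with Suc show ?case
    by simp
qed simp

lemma smooth_fun_coordinate: "smooth_fun n U (\<lambda>x. x j)"
  unfolding smooth_fun_def
proof
  fix k show "Ck k n U (\<lambda>x. x j)"
  proof (cases k)
    case 0
    then show ?thesis
      by (simp add: continuous_map_Rn_coordinate continuous_map_from_subtopology)
  next
    case (Suc l)
    have "partial_deriv i (\<lambda>x. x j) = (\<lambda>x. if i = j then 1 else 0)" for i
      by (simp add: partial_deriv_coordinate fun_eq_iff)
    moreover have "(\<lambda>t. (x(i := t)) j) field_differentiable at (x i)" for i and x :: "nat \<Rightarrow> real"
      by (cases "i = j") (auto simp: field_differentiable_ident)
    ultimately show ?thesis
      by (auto simp: Suc continuous_map_Rn_coordinate continuous_map_from_subtopology Ck_const)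
  qed
qed

section \<open>Restricting and pasting smooth functions\<close>

lemma Ck_subset: "Ck k n U g \<Longrightarrow> V \<subseteq> U \<Longrightarrow> Ck k n V g"
  by (induction k arbitrary: g) (auto intro: continuous_map_from_subtopology_mono)

lemma smooth_fun_subset: "smooth_fun n U g \<Longrightarrow> V \<subseteq> U \<Longrightarrow> smooth_fun n V g"
  unfolding smooth_fun_def by (blast intro: Ck_subset)

lemma continuous_map_locally:
  assumes "\<And>u. u \<in> U \<Longrightarrow> \<exists>N g'. openin X N \<and> u \<in> N \<and> N \<subseteq> U \<and>
      continuous_map (subtopology X N) Z g' \<and> (\<forall>x\<in>N. g x = g' x)"
  shows "continuous_map (subtopology X U) Z g"
proof -
  obtain N g' where N: "\<And>u. u \<in> U \<Longrightarrow> openin X (N u) \<and> u \<in> N u \<and> N u \<subseteq> U \<and>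
      continuous_map (subtopology X (N u)) Z (g' u) \<and> (\<forall>x\<in>N u. g x = g' u x)"
    using assms by metis
  show ?thesis
  proof (rule pasting_lemma[of U _ N _ "\<lambda>u. g"])
    fix u assume u: "u \<in> U"
    show "openin (subtopology X U) (N u)"
      using N[OF u] by (auto simp: openin_subtopology)
    have "subtopology (subtopology X U) (N u) = subtopology X (N u)"
      using N[OF u] by (simp add: subtopology_subtopology inf.absorb2)
    moreover have "continuous_map (subtopology X (N u)) Z g"
      using N[OF u] by (auto intro: continuous_map_eq)
    ultimately show "continuous_map (subtopology (subtopology X U) (N u)) Z g"
      by simp
  qed (use N in auto)
qed

text \<open>Induction on the order: continuity is pasted, while derivatives at a point can be read
  off the local representative.\<close>

lemma Ck_locally:
  assumes "\<And>u. u \<in> U \<Longrightarrow> \<exists>N g'. domain n N \<and> u \<in> N \<and> N \<subseteq> U \<and> Ck k n N g' \<and> (\<forall>x\<in>N. g x = g' x)"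
  shows "Ck k n U g"
  using assms
proof (induction k arbitrary: g)
  case 0
  then show ?case
    unfolding Ck.simps by (rule continuous_map_locally)
next
  case (Suc k)
  have "continuous_map (subtopology (Euclidean_space n) U) euclideanreal g"
  proof (rule continuous_map_locally)
    fix u assume "u \<in> U"
    from Suc.prems[OF this]
    obtain N g' where "domain n N" "u \<in> N" "N \<subseteq> U" "Ck (Suc k) n N g'" "\<forall>x\<in>N. g x = g' x"
      by blast
    then show "\<exists>N g'. domain n N \<and> u \<in> N \<and> N \<subseteq> U \<and>
        continuous_map (subtopology (Euclidean_space n) N) euclideanreal g' \<and> (\<forall>x\<in>N. g x = g' x)"
      by (intro exI[of _ N] exI[of _ g']) simp
  qed
  moreover have "(\<lambda>t. g (u(i := t))) field_differentiable at (u i)" if i: "i < n" and u: "u \<in> U" for i u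
  proof -
    from Suc.prems[OF u]
    obtain N g' where N: "domain n N" "u \<in> N" "Ck (Suc k) n N g'" "\<And>x. x \<in> N \<Longrightarrow> g x = g' x"
      by blast
    have "(\<lambda>t. g' (u(i := t))) field_differentiable at (u i)"
      using N(2,3) i by simp
    with partial_deriv_cong(2)[OF N(1,2) i, of g g'] N(4) show ?thesis
      by blast
  qed
  moreover have "Ck k n U (partial_deriv i g)" if i: "i < n" for i
  proof (rule Suc.IH)
    fix u assume "u \<in> U"
    from Suc.prems[OF this]
    obtain N g' where N: "domain n N" "u \<in> N" "N \<subseteq> U" "Ck (Suc k) n N g'"
        "\<And>x. x \<in> N \<Longrightarrow> g x = g' x"
      by blast
    \<comment> \<open>\<open>g\<close> and \<open>g'\<close> agree on the whole open set
      \<open>N\<close>, so \<open>partial_deriv i g'\<close> is a local representative for the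
      induction hypothesis.\<close>
    have "partial_deriv i g x = partial_deriv i g' x" if "x \<in> N" for x
      using N(1) that i N(5) by (rule partial_deriv_cong(1))
    moreover have "Ck k n N (partial_deriv i g')"
      using N(4) i by simp
    ultimately show "\<exists>N g'. domain n N \<and> u \<in> N \<and> N \<subseteq> U \<and> Ck k n N g' \<and>
        (\<forall>x\<in>N. partial_deriv i g x = g' x)"
      using N(1-3) by blast
  qed
  ultimately show ?case
    unfolding Ck.simps by blast
qed

lemma smooth_fun_locally:
  assumes "\<And>u. u \<in> U \<Longrightarrow>
    \<exists>N g'. domain n N \<and> u \<in> N \<and> N \<subseteq> U \<and> smooth_fun n N g' \<and> (\<forall>x\<in>N. g x = g' x)"
  shows "smooth_fun n U g"
  unfolding smooth_fun_def
proof (intro allI Ck_locally)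
  fix k u assume "u \<in> U"
  then obtain N g' where "domain n N" "u \<in> N" "N \<subseteq> U" "smooth_fun n N g'" "\<forall>x\<in>N. g x = g' x"
    using assms by blast
  then show "\<exists>N g'. domain n N \<and> u \<in> N \<and> N \<subseteq> U \<and> Ck k n N g' \<and> (\<forall>x\<in>N. g x = g' x)"
    unfolding smooth_fun_def by blast
qed

section \<open>Smooth maps between domains and products of domains\<close>

lemma smooth_between_inclusion:
  "domain n V \<Longrightarrow> domain n U \<Longrightarrow> V \<subseteq> U \<Longrightarrow> smooth_between n V n U (\<lambda>x. x)"
  by (auto simp: smooth_between_def smooth_fun_coordinate)

lemma domain_vimage:
  assumes "smooth_between n' U' n U F" and "domain n V"
  shows "domain n' {x \<in> U'. F x \<in> V}"
proof -
  have F: "domain n' U'" "F \<in> U' \<rightarrow> U" "U \<subseteq> Rn n" "\<And>j. j < n \<Longrightarrow> smooth_fun n' U' (\<lambda>x. F x j)"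
    using assms(1) openin_subset by (auto simp: smooth_between_def)
  have "continuous_map (subtopology (Euclidean_space n') U') (Euclidean_space n) F"
  proof (rule continuous_map_into_Rn)
    fix j assume "j < n"
    then have "Ck 0 n' U' (\<lambda>x. F x j)"
      using F(4) unfolding smooth_fun_def by blast
    then show "continuous_map (subtopology (Euclidean_space n') U') euclideanreal (\<lambda>x. F x j)"
      by simp
  qed (use F in auto)
  from openin_continuous_map_preimage[OF this assms(2)]
  have "openin (subtopology (Euclidean_space n') U')
    {x \<in> topspace (subtopology (Euclidean_space n') U'). F x \<in> V}" .
  \<comment> \<open>\<open>U'\<close> is itself open, so a relatively open subset of it is a
    domain.\<close>
  then have "domain n' {x \<in> topspace (subtopology (Euclidean_space n') U'). F x \<in> V}"
    using F(1) openin_trans_full by blast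
  moreover have "topspace (subtopology (Euclidean_space n') U') = U'"
    using F(1) openin_subset by auto
  ultimately show ?thesis
    by (simp only:)
qed

lemma smooth_between_restrict:
  assumes "smooth_between n' U' n U F" and "domain n' V'" and "V' \<subseteq> U'" and "domain n V"
    and "F ` V' \<subseteq> V"
  shows "smooth_between n' V' n V F"
  using assms unfolding smooth_between_def by (auto intro: smooth_fun_subset)

lemma domain_prod_domain:
  assumes "domain k U'" and "domain n U"
  shows "domain (k + n) (prod_domain k n U' U)"
proof -
  have "continuous_map (Euclidean_space (k + n)) (Euclidean_space k) (fst_part k)"
    using continuous_map_Rn_coordinate by (intro continuous_map_into_Rn) (auto simp: fst_part_def topspace_Euclidean_space)
  from openin_continuous_map_preimage[OF this assms(1)]
  have 1: "domain (k + n) {w \<in> Rn (k + n). fst_part k w \<in> U'}" .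
  have "continuous_map (Euclidean_space (k + n)) (Euclidean_space n) (snd_part k)"
    using continuous_map_Rn_coordinate by (intro continuous_map_into_Rn) (auto simp: snd_part_def topspace_Euclidean_space)
  from openin_continuous_map_preimage[OF this assms(2)]
  have 2: "domain (k + n) {w \<in> Rn (k + n). snd_part k w \<in> U}" .
  have "prod_domain k n U' U =
      {w \<in> Rn (k + n). fst_part k w \<in> U'} \<inter> {w \<in> Rn (k + n). snd_part k w \<in> U}"
    by (auto simp: prod_domain_def)
  with openin_Int[OF 1 2] show ?thesis
    by simp
qed

section \<open>Diffeologies and subductions\<close>

lemma diffeology_on_domain: "diffeology_on X D \<Longrightarrow> (n, U, p) \<in> D \<Longrightarrow> domain n U"
  and diffeology_on_typed: "diffeology_on X D \<Longrightarrow> (n, U, p) \<in> D \<Longrightarrow> p \<in> U \<rightarrow>\<^sub>E X"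
  by (auto simp only: diffeology_on_def split: prod.splits)

lemma diffeology_on_const: "diffeology_on X D \<Longrightarrow> domain n U \<Longrightarrow> x \<in> X \<Longrightarrow> (n, U, \<lambda>u\<in>U. x) \<in> D"
  by (simp add: diffeology_on_def)

lemma diffeology_on_compose:
  assumes "diffeology_on X D" and "(n, U, p) \<in> D" and "smooth_between n' U' n U F"
  shows "(n', U', compose U' p F) \<in> D"
proof -
  have "\<forall>(n, U, p) \<in> D. \<forall>n' U' F. smooth_between n' U' n U F \<longrightarrow> (n', U', compose U' p F) \<in> D"
    using assms(1) unfolding diffeology_on_def by (elim conjE)
  from bspec[OF this assms(2)] assms(3) show ?thesis
    by simp
qed

lemma diffeology_on_locally:
  assumes "diffeology_on X D" and "domain n U" and "p \<in> U \<rightarrow>\<^sub>E X"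
    and "\<And>u. u \<in> U \<Longrightarrow> \<exists>V. domain n V \<and> u \<in> V \<and> V \<subseteq> U \<and> (n, V, restrict p V) \<in> D"
  shows "(n, U, p) \<in> D"
proof -
  have "\<forall>n U p. domain n U \<longrightarrow> p \<in> U \<rightarrow>\<^sub>E X \<longrightarrow>
      (\<forall>u\<in>U. \<exists>V. domain n V \<and> u \<in> V \<and> V \<subseteq> U \<and> (n, V, restrict p V) \<in> D) \<longrightarrow> (n, U, p) \<in> D"
    using assms(1) unfolding diffeology_on_def by (elim conjE)
  with assms(2-4) show ?thesis
    by blast
qed

lemma diffeology_on_restrict:
  assumes "diffeology_on X D" and "(n, U, p) \<in> D" and "domain n V" and "V \<subseteq> U"
  shows "(n, V, restrict p V) \<in> D"
proof -
  have "(n, V, compose V p (\<lambda>x. x)) \<in> D"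
    using diffeology_on_domain[OF assms(1,2)] assms(3,4)
    by (intro diffeology_on_compose[OF assms(1,2)] smooth_between_inclusion)
  then show ?thesis
    by (simp add: compose_def)
qed

lemma diffeology_onI:
  assumes "\<And>n U p. (n, U, p) \<in> D \<Longrightarrow> domain n U" and "\<And>n U p. (n, U, p) \<in> D \<Longrightarrow> p \<in> U \<rightarrow>\<^sub>E X"
    and "\<And>n U x. domain n U \<Longrightarrow> x \<in> X \<Longrightarrow> (n, U, \<lambda>u\<in>U. x) \<in> D"
    and "\<And>n U p n' U' F. (n, U, p) \<in> D \<Longrightarrow> smooth_between n' U' n U F \<Longrightarrow>
      (n', U', compose U' p F) \<in> D"
    and "\<And>n U p. domain n U \<Longrightarrow> p \<in> U \<rightarrow>\<^sub>E X \<Longrightarrow>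
      (\<And>u. u \<in> U \<Longrightarrow> \<exists>V. domain n V \<and> u \<in> V \<and> V \<subseteq> U \<and> (n, V, restrict p V) \<in> D) \<Longrightarrow>
      (n, U, p) \<in> D"
  shows "diffeology_on X D"
  unfolding diffeology_on_def
proof (intro conjI)
  show "\<forall>(n, U, p)\<in>D. domain n U \<and> p \<in> U \<rightarrow>\<^sub>E X"
    using assms(1,2) by blast
  show "\<forall>n U x. domain n U \<longrightarrow> x \<in> X \<longrightarrow> (n, U, \<lambda>u\<in>U. x) \<in> D"
    using assms(3) by simp
  show "\<forall>(n, U, p)\<in>D. \<forall>n' U' F. smooth_between n' U' n U F \<longrightarrow> (n', U', compose U' p F) \<in> D"
    using assms(4) by auto
  show "\<forall>n U p. domain n U \<longrightarrow> p \<in> U \<rightarrow>\<^sub>E X \<longrightarrow>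
      (\<forall>u\<in>U. \<exists>V. domain n V \<and> u \<in> V \<and> V \<subseteq> U \<and> (n, V, restrict p V) \<in> D) \<longrightarrow> (n, U, p) \<in> D"
    by (intro allI impI assms(5)) auto
qed

lemma diffeology_on_sub_diff:
  assumes D: "diffeology_on X D" and S: "S \<subseteq> X"
  shows "diffeology_on S (sub_diff S D)"
proof (rule diffeology_onI)
  fix n U p assume "(n, U, p) \<in> sub_diff S D"
  then have p: "(n, U, p) \<in> D" "p ` U \<subseteq> S"
    by (auto simp: sub_diff_def)
  show "domain n U" "p \<in> U \<rightarrow>\<^sub>E S"
    using diffeology_on_domain[OF D p(1)] diffeology_on_typed[OF D p(1)] p(2)
    by (auto simp: PiE_def)
  show "(n', U', compose U' p F) \<in> sub_diff S D" if F: "smooth_between n' U' n U F" for n' U' F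
  proof -
    have "compose U' p F ` U' \<subseteq> S"
      using F p(2) by (auto simp: compose_def smooth_between_def)
    with diffeology_on_compose[OF D p(1) F] show ?thesis
      by (simp add: sub_diff_def)
  qed
next
  fix n U x assume "domain n U" "x \<in> S"
  with diffeology_on_const[OF D] S show "(n, U, \<lambda>u\<in>U. x) \<in> sub_diff S D"
    by (auto simp: sub_diff_def)
next
  fix n U p
  assume U: "domain n U" and p: "p \<in> U \<rightarrow>\<^sub>E S"
    and loc: "\<And>u. u \<in> U \<Longrightarrow> \<exists>V. domain n V \<and> u \<in> V \<and> V \<subseteq> U \<and> (n, V, restrict p V) \<in> sub_diff S D"
  have "p \<in> U \<rightarrow>\<^sub>E X"
    using p S by (auto simp: PiE_def)
  then have "(n, U, p) \<in> D"
  proof (rule diffeology_on_locally[OF D U])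
    fix u assume "u \<in> U"
    from loc[OF this] show "\<exists>V. domain n V \<and> u \<in> V \<and> V \<subseteq> U \<and> (n, V, restrict p V) \<in> D"
      by (auto simp: sub_diff_def)
  qed
  with p show "(n, U, p) \<in> sub_diff S D"
    by (auto simp: sub_diff_def)
qed

text \<open>Keeps the intermediate restriction to the image of \<open>h\<close> away from its
  default value: \<open>form_pullback\<close> is zero on anything that is not a plot of its
  source.\<close>

lemma sub_diff_image:
  assumes "diff_smooth S DS Z DZ h" and "(n, U, p) \<in> DS" and "p ` U \<subseteq> S"
  shows "(n, U, compose U h p) \<in> sub_diff (h ` S) DZ"
  using assms by (auto simp: diff_smooth_def sub_diff_def compose_def)

section \<open>Local lifts through a map\<close>

text \<open>The subduction condition at a single point \<open>u\<close>, with neighbourhood and lift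
  as explicit arguments so that lifts can be chosen and compared.\<close>

definition local_lift ::
  "'a plot set \<Rightarrow> ('a \<Rightarrow> 'b) \<Rightarrow> nat \<Rightarrow> (nat \<Rightarrow> real) set \<Rightarrow> ((nat \<Rightarrow> real) \<Rightarrow> 'b) \<Rightarrow> (nat \<Rightarrow> real) \<Rightarrow>
   (nat \<Rightarrow> real) set \<Rightarrow> ((nat \<Rightarrow> real) \<Rightarrow> 'a) \<Rightarrow> bool"
  where "local_lift DA g n U p u V q \<longleftrightarrow>
    domain n V \<and> u \<in> V \<and> V \<subseteq> U \<and> (n, V, q) \<in> DA \<and> restrict p V = compose V g q"

lemma subduction_local_lift:
  "subduction A DA B DB g \<Longrightarrow> (n, U, p) \<in> DB \<Longrightarrow> u \<in> U \<Longrightarrow> \<exists>V q. local_lift DA g n U p u V q"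
  unfolding subduction_def local_lift_def by blast

lemma local_lift_eq:
  assumes "local_lift DA g n U p u V q" and "x \<in> V"
  shows "p x = g (q x)"
proof -
  have "restrict p V x = compose V g q x"
    using assms(1) by (simp add: local_lift_def)
  with assms(2) show ?thesis
    by (simp add: compose_def)
qed

text \<open>One lift serves every point of its domain; this makes pointwise constructions through
  lifts uniform near each point.\<close>

lemma local_lift_mono: "local_lift DA g n U p u V q \<Longrightarrow> x \<in> V \<Longrightarrow> local_lift DA g n U p x V q"
  by (auto simp: local_lift_def)

lemma diff_smoothD: "diff_smooth A DA B DB g \<Longrightarrow> (n, U, p) \<in> DA \<Longrightarrow> (n, U, compose U g p) \<in> DB"
  by (auto simp: diff_smooth_def)

text \<open>The lift at \<open>F u\<close> is precomposed with \<open>F\<close> on the preimage of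
  its neighbourhood, which is open because smooth maps are continuous.\<close>

lemma local_lift_compose:
  assumes A: "diffeology_on A DA" and q: "local_lift DA g n U p (F u) V q"
    and F: "smooth_between n' U' n U F" and u: "u \<in> U'" and V': "V' = {x \<in> U'. F x \<in> V}"
  shows "local_lift DA g n' U' (compose U' p F) u V' (compose V' q F)"
    and "smooth_between n' V' n V F"
proof -
  have V: "domain n V" "F u \<in> V" "(n, V, q) \<in> DA"
    using q by (auto simp: local_lift_def)
  have dom: "domain n' V'" "u \<in> V'" "V' \<subseteq> U'" "F ` V' \<subseteq> V"
    using domain_vimage[OF F V(1)] u V(2) by (auto simp: V')
  show F': "smooth_between n' V' n V F"
    by (rule smooth_between_restrict[OF F dom(1,3) V(1) dom(4)])
  have "restrict (compose U' p F) V' x = compose V' g (compose V' q F) x" for x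
    using dom(3,4) local_lift_eq[OF q] by (auto simp: compose_def)
  then show "local_lift DA g n' U' (compose U' p F) u V' (compose V' q F)"
    using dom diffeology_on_compose[OF A V(3) F'] by (simp add: local_lift_def fun_eq_iff)
qed

section \<open>Forms and subductions\<close>

text \<open>The partial derivatives of coordinates are Kronecker deltas; \<open>v \<in> Rn n\<close>
  covers the positions from \<open>n\<close> on, where \<open>differential\<close> is zero by
  definition.\<close>

lemma differential_id:
  assumes "v \<in> Rn n"
  shows "differential n n (\<lambda>x. x) u v = v"
proof
  fix j
  have "(\<Sum>i<n. (if i = j then 1 else 0) * v i) = (\<Sum>i<n. if i = j then v i else 0)"
    by (rule sum.cong) auto
  then show "differential n n (\<lambda>x. x) u v j = v j"
    using assms by (simp add: differential_def partial_deriv_coordinate topspace_Euclidean_space)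
qed

lemma forms_outside:
  assumes "\<omega> \<in> forms m D" and "P \<notin> D"
  shows "\<omega> P = (\<lambda>u vs. 0)"
proof -
  have "\<forall>P. P \<notin> D \<longrightarrow> \<omega> P = (\<lambda>u vs. 0)"
    using assms(1) unfolding forms_def by (elim CollectE conjE)
  with assms(2) show ?thesis
    by blast
qed

lemma forms_ordinary:
  assumes "\<omega> \<in> forms m D" and "(n, U, p) \<in> D"
  shows "ordinary_form m n U (\<omega> (n, U, p))"
proof -
  have "\<forall>(n, U, p) \<in> D. ordinary_form m n U (\<omega> (n, U, p))"
    using assms(1) unfolding forms_def by (elim CollectE conjE)
  from bspec[OF this assms(2)] show ?thesis
    by simp
qed

lemma forms_pullback:
  assumes "\<omega> \<in> forms m D" and "(n, U, p) \<in> D" and "smooth_between n' U' n U F"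
  shows "\<omega> (n', U', compose U' p F) = ordinary_pullback m n' U' n F (\<omega> (n, U, p))"
proof -
  have "\<forall>(n, U, p) \<in> D. \<forall>n' U' F. smooth_between n' U' n U F \<longrightarrow>
       \<omega> (n', U', compose U' p F) = ordinary_pullback m n' U' n F (\<omega> (n, U, p))"
    using assms(1) unfolding forms_def by (elim CollectE conjE)
  from bspec[OF this assms(2)] assms(3) show ?thesis
    by simp
qed

lemma formsI:
  assumes "\<And>P. P \<notin> D \<Longrightarrow> \<omega> P = (\<lambda>u vs. 0)"
    and "\<And>n U p. (n, U, p) \<in> D \<Longrightarrow> ordinary_form m n U (\<omega> (n, U, p))"
    and "\<And>n U p n' U' F. (n, U, p) \<in> D \<Longrightarrow> smooth_between n' U' n U F \<Longrightarrow>
       \<omega> (n', U', compose U' p F) = ordinary_pullback m n' U' n F (\<omega> (n, U, p))"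
  shows "\<omega> \<in> forms m D"
  unfolding forms_def
proof (intro CollectI conjI)
  show "\<forall>P. P \<notin> D \<longrightarrow> \<omega> P = (\<lambda>u vs. 0)"
    using assms(1) by blast
  show "\<forall>(n, U, p) \<in> D. ordinary_form m n U (\<omega> (n, U, p))"
    using assms(2) by blast
  show "\<forall>(n, U, p) \<in> D. \<forall>n' U' F. smooth_between n' U' n U F \<longrightarrow>
       \<omega> (n', U', compose U' p F) = ordinary_pullback m n' U' n F (\<omega> (n, U, p))"
    using assms(3) by blast
qed

lemma forms_off_domain: "\<omega> \<in> forms m D \<Longrightarrow> u \<notin> U \<Longrightarrow> \<omega> (n, U, p) u = (\<lambda>vs. 0)"
  using forms_ordinary[of \<omega> m D n U p] forms_outside[of \<omega> m D "(n, U, p)"]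
  by (cases "(n, U, p) \<in> D") (auto simp: ordinary_form_def)

lemma forms_off_tuples:
  assumes "\<omega> \<in> forms m D" and "vs \<notin> tuples m n"
  shows "\<omega> (n, U, p) u vs = 0"
proof (cases "(n, U, p) \<in> D \<and> u \<in> U")
  case True
  then have "\<omega> (n, U, p) u \<in> alt_forms m n"
    using forms_ordinary[OF assms(1)] by (simp add: ordinary_form_def smooth_into_alt_def)
  with assms(2) show ?thesis
    by (simp add: alt_forms_def)
next
  case False
  then show ?thesis
    using forms_outside[OF assms(1), of "(n, U, p)"] forms_off_domain[OF assms(1)] by auto
qed

text \<open>Restriction to \<open>V\<close> is composition with the inclusion, whose differential is
  the identity. Lists outside \<open>tuples m n\<close> give zero on both sides. This makes forms
  local.\<close>

lemma forms_restrict: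
  assumes \<omega>: "\<omega> \<in> forms m D" and p: "(n, U, p) \<in> D"
    and "domain n U" and "domain n V" and "V \<subseteq> U" and "u \<in> V"
  shows "\<omega> (n, V, restrict p V) u = \<omega> (n, U, p) u"
proof
  fix vs
  have "\<omega> (n, V, restrict p V) = \<omega> (n, V, compose V p (\<lambda>x. x))"
    by (simp add: compose_def)
  also have "\<dots> = ordinary_pullback m n V n (\<lambda>x. x) (\<omega> (n, U, p))"
    using assms by (intro forms_pullback[OF \<omega> p] smooth_between_inclusion)
  finally have *: "\<omega> (n, V, restrict p V) = ordinary_pullback m n V n (\<lambda>x. x) (\<omega> (n, U, p))" .
  show "\<omega> (n, V, restrict p V) u vs = \<omega> (n, U, p) u vs"
  proof (cases "vs \<in> tuples m n")
    case True
    then have "map (differential n n (\<lambda>x. x) u) vs = vs"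
      by (intro map_idI differential_id) (auto simp: tuples_def)
    with True assms(6) show ?thesis
      by (simp add: * ordinary_pullback_def)
  next
    case False
    then show ?thesis
      using forms_off_tuples[OF \<omega>] by simp
  qed
qed

lemma form_pullback_in_forms:
  assumes A: "diffeology_on A DA" and g: "diff_smooth A DA B DB g" and \<omega>: "\<omega> \<in> forms m DB"
  shows "form_pullback DA g \<omega> \<in> forms m DA"
proof (rule formsI)
  fix n U p assume p: "(n, U, p) \<in> DA"
  note gp = diff_smoothD[OF g p]
  show "ordinary_form m n U (form_pullback DA g \<omega> (n, U, p))"
    using forms_ordinary[OF \<omega> gp] p by (simp add: form_pullback_def)
  show "form_pullback DA g \<omega> (n', U', compose U' p F) =
      ordinary_pullback m n' U' n F (form_pullback DA g \<omega> (n, U, p))"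
    if F: "smooth_between n' U' n U F" for n' U' F
  proof -
    have "compose U' g (compose U' p F) = compose U' (compose U g p) F"
      using F by (intro compose_assoc) (simp add: smooth_between_def)
    then show ?thesis
      using forms_pullback[OF \<omega> gp F] diffeology_on_compose[OF A p F] p
      by (simp add: form_pullback_def)
  qed
qed (auto simp: form_pullback_def)

text \<open>The hypothesis ensures that the inner pullback is evaluated at a plot of
  \<open>DB\<close> instead of returning its default zero.\<close>

lemma form_pullback_comp:
  assumes "\<And>n U p. (n, U, p) \<in> DA \<Longrightarrow> (n, U, compose U h p) \<in> DB"
  shows "form_pullback DA h (form_pullback DB g \<omega>) = form_pullback DA (g \<circ> h) \<omega>"
proof -
  have "compose U g (compose U h p) = compose U (g \<circ> h) p" for U and p :: "(nat \<Rightarrow> real) \<Rightarrow> _"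
    unfolding compose_def by (intro restrict_ext) simp
  with assms show ?thesis
    unfolding form_pullback_def by (intro ext) auto
qed

lemma form_pullback_cong:
  assumes "diffeology_on A DA" and "\<And>x. x \<in> A \<Longrightarrow> g x = h x"
  shows "form_pullback DA g = form_pullback DA h"
proof -
  have "compose U g p = compose U h p" if "(n, U, p) \<in> DA" for n U p
    using diffeology_on_typed[OF assms(1) that] assms(2)
    unfolding compose_def by (intro restrict_ext) auto
  then show ?thesis
    unfolding form_pullback_def by (intro ext) auto
qed

text \<open>Near each point a plot of \<open>B\<close> factors through a plot of \<open>A\<close>,
  and forms are local, so every value of a form can be recovered from its pullback.\<close>

lemma form_pullback_inj:
  fixes \<omega> \<omega>' :: "'b form"
  assumes DB: "diffeology_on B DB" and g: "subduction A DA B DB g"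
    and \<omega>: "\<omega> \<in> forms m DB" and \<omega>': "\<omega>' \<in> forms m DB"
    and eq: "form_pullback DA g \<omega> = form_pullback DA g \<omega>'"
  shows "\<omega> = \<omega>'"
proof (rule ext)+
  fix P :: "'b plot" and u vs
  obtain n U p where P: "P = (n, U, p)"
    by (cases P)
  show "\<omega> P u vs = \<omega>' P u vs"
  proof (cases "P \<in> DB \<and> u \<in> U")
    case True
    then have p: "(n, U, p) \<in> DB" and u: "u \<in> U"
      by (auto simp: P)
    from subduction_local_lift[OF g p u]
    obtain V q where q: "local_lift DA g n U p u V q"
      by blast
    then have V: "domain n V" "V \<subseteq> U" "u \<in> V" "(n, V, q) \<in> DA" "restrict p V = compose V g q"
      by (auto simp: local_lift_def)
    have *: "\<eta> (n, U, p) u = form_pullback DA g \<eta> (n, V, q) u" if "\<eta> \<in> forms m DB" for \<eta>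
      using forms_restrict[OF that p diffeology_on_domain[OF DB p] V(1-3)] V(4,5)
      by (simp add: form_pullback_def)
    show ?thesis
      using *[OF \<omega>] *[OF \<omega>'] eq by (simp add: P)
  next
    case False
    then show ?thesis
      using forms_outside[OF \<omega>, of P] forms_outside[OF \<omega>', of P]
        forms_off_domain[OF \<omega>, of u U n p] forms_off_domain[OF \<omega>', of u U n p]
      by (auto simp: P)
  qed
qed

section \<open>Basic forms and their descent along a subduction\<close>

text \<open>Forms that see a plot only through its composition with \<open>g\<close>; for a
  subduction these turn out to be exactly the pullbacks from the target.\<close>

abbreviation basic_forms :: "nat \<Rightarrow> 'a plot set \<Rightarrow> ('a \<Rightarrow> 'b) \<Rightarrow> 'a form set"
  where "basic_forms m D g \<equiv> forms_inv_wrt m D (\<lambda>x x'. g x = g x')"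

lemma forms_inv_wrt_forms: "\<omega> \<in> forms_inv_wrt m D E \<Longrightarrow> \<omega> \<in> forms m D"
  by (simp add: forms_inv_wrt_def)

lemma basic_formsD:
  assumes "\<omega> \<in> basic_forms m D g" and "(n, U, p) \<in> D" and "(n, U, p') \<in> D"
    and "\<And>u. u \<in> U \<Longrightarrow> g (p u) = g (p' u)"
  shows "\<omega> (n, U, p) = \<omega> (n, U, p')"
proof -
  have "plots_equivalent (\<lambda>x x'. g x = g x') (n, U, p) (n, U, p')"
    using assms(4) by (simp add: plots_equivalent_def)
  with assms(1-3) show ?thesis
    unfolding forms_inv_wrt_def by blast
qed

text \<open>Equivalence of plots tests the relation only at distinct values, and those lie in
  \<open>X\<close>.\<close>

lemma forms_inv_wrt_cong:
  assumes D: "diffeology_on X D"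
    and E: "\<And>x x'. x \<in> X \<Longrightarrow> x' \<in> X \<Longrightarrow> x \<noteq> x' \<Longrightarrow> E x x' \<longleftrightarrow> E' x x'"
  shows "forms_inv_wrt m D E = forms_inv_wrt m D E'"
proof -
  have "plots_equivalent E P P' \<longleftrightarrow> plots_equivalent E' P P'" if P: "P \<in> D" "P' \<in> D" for P P'
  proof -
    obtain n U p n' U' p' where [simp]: "P = (n, U, p)" "P' = (n', U', p')"
      by (cases P, cases P')
    have "p \<in> U \<rightarrow> X" "p' \<in> U' \<rightarrow> X"
      using P diffeology_on_typed[OF D] by (auto simp: PiE_def)
    with E show ?thesis
      by (auto simp: plots_equivalent_def Pi_iff)
  qed
  then show ?thesis
    unfolding forms_inv_wrt_def by auto
qed

lemma form_pullback_in_basic_forms: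
  assumes A: "diffeology_on A DA" and g: "diff_smooth A DA B DB g" and \<omega>: "\<omega> \<in> forms m DB"
  shows "form_pullback DA g \<omega> \<in> basic_forms m DA g"
  unfolding forms_inv_wrt_def
proof (intro CollectI conjI ballI impI)
  fix P P' assume P: "P \<in> DA" "P' \<in> DA" "plots_equivalent (\<lambda>x x'. g x = g x') P P'"
  then obtain n U p p' where [simp]: "P = (n, U, p)" "P' = (n, U, p')"
    and eq: "\<And>u. u \<in> U \<Longrightarrow> p u \<noteq> p' u \<Longrightarrow> g (p u) = g (p' u)"
    unfolding plots_equivalent_def by blast
  have "compose U g p = compose U g p'"
    unfolding compose_def by (rule restrict_ext) (metis eq)
  with P(1,2) show "form_pullback DA g \<omega> P = form_pullback DA g \<omega> P'"
    by (simp add: form_pullback_def)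
qed (rule form_pullback_in_forms[OF assms])

text \<open>Inverts the pullback point by point: the value at \<open>u\<close> is read off a local
  lift chosen for that point. For basic forms the choice is immaterial. Elsewhere the value is the
  zero that \<open>forms\<close> prescribes.\<close>

definition descend :: "'a plot set \<Rightarrow> 'b plot set \<Rightarrow> ('a \<Rightarrow> 'b) \<Rightarrow> 'a form \<Rightarrow> 'b form"
  where "descend DA DB g \<omega> = (\<lambda>(n, U, p) u.
    if (n, U, p) \<in> DB \<and> u \<in> U
    then (let (V, q) = SOME (V, q). local_lift DA g n U p u V q in \<omega> (n, V, q) u)
    else (\<lambda>vs. 0))"

text \<open>On the intersection of their domains both lifts have the same composition with
  \<open>g\<close>, so a basic form cannot tell them apart there; locality transfers this to the
  original lifts.\<close>

lemma local_lift_unique_value: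
  assumes A: "diffeology_on A DA" and \<omega>: "\<omega> \<in> basic_forms m DA g"
    and q: "local_lift DA g n U p u V q" and q': "local_lift DA g n U p u V' q'"
  shows "\<omega> (n, V, q) u = \<omega> (n, V', q') u"
proof -
  define N where "N = V \<inter> V'"
  have V: "domain n V" "(n, V, q) \<in> DA" "u \<in> V" and V': "domain n V'" "(n, V', q') \<in> DA" "u \<in> V'"
    using q q' by (auto simp: local_lift_def)
  have N: "domain n N" "u \<in> N" "N \<subseteq> V" "N \<subseteq> V'"
    using V V' by (auto simp: N_def)
  note \<omega>' = forms_inv_wrt_forms[OF \<omega>]
  have "\<omega> (n, N, restrict q N) = \<omega> (n, N, restrict q' N)"
  proof (rule basic_formsD[OF \<omega>])
    show "(n, N, restrict q N) \<in> DA" "(n, N, restrict q' N) \<in> DA"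
      using diffeology_on_restrict[OF A] V V' N by auto
    show "g (restrict q N x) = g (restrict q' N x)" if "x \<in> N" for x
      using local_lift_eq[OF q, of x] local_lift_eq[OF q', of x] that by (simp add: N_def)
  qed
  then show ?thesis
    using forms_restrict[OF \<omega>' V(2,1) N(1,3,2)] forms_restrict[OF \<omega>' V'(2,1) N(1,4,2)] by simp
qed

lemma descend_eq:
  assumes A: "diffeology_on A DA" and \<omega>: "\<omega> \<in> basic_forms m DA g"
    and p: "(n, U, p) \<in> DB" and q: "local_lift DA g n U p u V q"
  shows "descend DA DB g \<omega> (n, U, p) u = \<omega> (n, V, q) u"
proof -
  have u: "u \<in> U"
    using q by (auto simp: local_lift_def)
  define W where "W = (SOME (V, q). local_lift DA g n U p u V q)"
  have "case W of (V, q) \<Rightarrow> local_lift DA g n U p u V q"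
    unfolding W_def by (rule someI[of _ "(V, q)"]) (simp add: q)
  then obtain V' q' where W: "W = (V', q')" and q': "local_lift DA g n U p u V' q'"
    by (cases W) simp
  have "descend DA DB g \<omega> (n, U, p) u = \<omega> (n, V', q') u"
    using p u W by (simp add: descend_def W_def)
  also have "\<dots> = \<omega> (n, V, q) u"
    by (rule local_lift_unique_value[OF A \<omega> q' q])
  finally show ?thesis .
qed

lemma smooth_into_alt_locally:
  assumes "\<And>u. u \<in> U \<Longrightarrow> \<exists>N \<eta>'. domain d N \<and> u \<in> N \<and> N \<subseteq> U \<and> smooth_into_alt m n d N \<eta>' \<and>
      (\<forall>x\<in>N. \<eta> x = \<eta>' x)"
  shows "smooth_into_alt m n d U \<eta>"
  unfolding smooth_into_alt_def
proof (intro conjI ballI)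
  fix u assume "u \<in> U"
  from assms[OF this] obtain N \<eta>' where "u \<in> N" "smooth_into_alt m n d N \<eta>'" "\<forall>x\<in>N. \<eta> x = \<eta>' x"
    by blast
  then show "\<eta> u \<in> alt_forms m n"
    by (simp add: smooth_into_alt_def)
next
  fix vs assume vs: "vs \<in> tuples m n"
  show "smooth_fun d U (\<lambda>u. \<eta> u vs)"
  proof (rule smooth_fun_locally)
    fix u assume "u \<in> U"
    from assms[OF this] obtain N \<eta>' where N: "domain d N" "u \<in> N" "N \<subseteq> U"
      "smooth_into_alt m n d N \<eta>'" "\<forall>x\<in>N. \<eta> x = \<eta>' x"
      by blast
    then have "smooth_fun d N (\<lambda>u. \<eta>' u vs)"
      using vs by (simp add: smooth_into_alt_def)
    with N show "\<exists>N g'. domain d N \<and> u \<in> N \<and> N \<subseteq> U \<and> smooth_fun d N g' \<and> (\<forall>x\<in>N. \<eta> x vs = g' x)"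
      by (intro exI[of _ N] exI[of _ "\<lambda>u. \<eta>' u vs"]) simp
  qed
qed

text \<open>Around each point one lift computes all values, so smoothness and compatibility with
  smooth maps are inherited from \<open>\<omega>\<close> on that lift.\<close>

lemma descend_in_forms:
  assumes A: "diffeology_on A DA" and B: "diffeology_on B DB" and g: "subduction A DA B DB g"
    and \<omega>: "\<omega> \<in> basic_forms m DA g"
  shows "descend DA DB g \<omega> \<in> forms m DB"
proof (rule formsI)
  fix P assume "P \<notin> DB"
  then show "descend DA DB g \<omega> P = (\<lambda>u vs. 0)"
    by (cases P) (simp add: descend_def fun_eq_iff)
next
  note \<omega>' = forms_inv_wrt_forms[OF \<omega>]
  fix n U p assume p: "(n, U, p) \<in> DB"
  note eq = descend_eq[OF A \<omega> p]
  have smooth: "smooth_into_alt m n n U (descend DA DB g \<omega> (n, U, p))"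
  proof (rule smooth_into_alt_locally)
    fix u assume "u \<in> U"
    from subduction_local_lift[OF g p this] obtain V q where q: "local_lift DA g n U p u V q"
      by blast
    have "\<forall>x\<in>V. descend DA DB g \<omega> (n, U, p) x = \<omega> (n, V, q) x"
      using eq local_lift_mono[OF q] by blast
    moreover have "smooth_into_alt m n n V (\<omega> (n, V, q))"
      using forms_ordinary[OF \<omega>', of n V q] q by (simp add: local_lift_def ordinary_form_def)
    ultimately show "\<exists>N \<eta>'. domain n N \<and> u \<in> N \<and> N \<subseteq> U \<and> smooth_into_alt m n n N \<eta>' \<and>
        (\<forall>x\<in>N. descend DA DB g \<omega> (n, U, p) x = \<eta>' x)"
      using q unfolding local_lift_def by blast
  qed
  then show "ordinary_form m n U (descend DA DB g \<omega> (n, U, p))"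
    by (simp add: ordinary_form_def descend_def)
  fix n' U' F assume F: "smooth_between n' U' n U F"
  show "descend DA DB g \<omega> (n', U', compose U' p F) =
      ordinary_pullback m n' U' n F (descend DA DB g \<omega> (n, U, p))"
  proof (rule ext)
    fix u
    show "descend DA DB g \<omega> (n', U', compose U' p F) u =
      ordinary_pullback m n' U' n F (descend DA DB g \<omega> (n, U, p)) u"
    proof (cases "u \<in> U'")
      case u: True
      then have "F u \<in> U"
        using F by (auto simp: smooth_between_def)
      from subduction_local_lift[OF g p this] obtain V q where q: "local_lift DA g n U p (F u) V q"
        by blast
      then have V: "(n, V, q) \<in> DA"
        by (simp add: local_lift_def)
      define V' where "V' = {x \<in> U'. F x \<in> V}"
      note q' = local_lift_compose[OF A q F u V'_def]
      have "descend DA DB g \<omega> (n', U', compose U' p F) u = \<omega> (n', V', compose V' q F) u"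
        by (rule descend_eq[OF A \<omega> diffeology_on_compose[OF B p F] q'(1)])
      also have "\<dots> = ordinary_pullback m n' V' n F (\<omega> (n, V, q)) u"
        by (simp add: forms_pullback[OF \<omega>' V q'(2)])
      \<comment> \<open>\<open>u\<close> lies in both \<open>V'\<close> and \<open>U'\<close>, and
        \<open>differential\<close> does not mention the domain, so the two pullbacks agree at
        \<open>u\<close>.\<close>
      also have "\<dots> = ordinary_pullback m n' U' n F (descend DA DB g \<omega> (n, U, p)) u"
        using u q'(1) eq[OF q] by (simp add: ordinary_pullback_def fun_eq_iff local_lift_def)
      finally show ?thesis .
    qed (simp add: descend_def ordinary_pullback_def fun_eq_iff)
  qed
qed

text \<open>A plot of \<open>A\<close> is itself a lift, over its whole domain, of its composition
  with \<open>g\<close>.\<close>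

lemma form_pullback_descend:
  fixes \<omega> :: "'a form"
  assumes A: "diffeology_on A DA" and g: "diff_smooth A DA B DB g"
    and \<omega>: "\<omega> \<in> basic_forms m DA g"
  shows "form_pullback DA g (descend DA DB g \<omega>) = \<omega>"
proof (rule ext)+
  fix P :: "'a plot" and u vs
  note \<omega>' = forms_inv_wrt_forms[OF \<omega>]
  obtain n U p where P: "P = (n, U, p)"
    by (cases P)
  show "form_pullback DA g (descend DA DB g \<omega>) P u vs = \<omega> P u vs"
  proof (cases "P \<in> DA \<and> u \<in> U")
    case True
    then have p: "(n, U, p) \<in> DA" and u: "u \<in> U"
      by (auto simp: P)
    have "restrict (compose U g p) U = compose U g p"
      by (simp add: compose_def)
    then have "local_lift DA g n U (compose U g p) u U p"
      using p u diffeology_on_domain[OF A p] by (simp add: local_lift_def)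
    from descend_eq[OF A \<omega> diff_smoothD[OF g p] this] p show ?thesis
      by (simp add: P form_pullback_def)
  next
    case False
    then show ?thesis
      using forms_outside[OF \<omega>', of P] forms_off_domain[OF \<omega>', of u U n p]
      by (auto simp: P form_pullback_def descend_def)
  qed
qed

section \<open>Smooth families of forms under pullback and descent\<close>

lemma form_diff_plot:
  assumes "(k, U', Q) \<in> form_diff m D"
  shows "domain k U'" and "Q \<in> U' \<rightarrow>\<^sub>E forms m D"
    and "(n, U, p) \<in> D \<Longrightarrow> smooth_into_alt m n (k + n) (prod_domain k n U' U)
       (\<lambda>w. Q (fst_part k w) (n, U, p) (snd_part k w))"
  using assms unfolding form_diff_def by auto

lemma form_diffI:
  assumes "domain k U'" and "Q \<in> U' \<rightarrow>\<^sub>E forms m D"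
    and "\<And>n U p. (n, U, p) \<in> D \<Longrightarrow> smooth_into_alt m n (k + n) (prod_domain k n U' U)
       (\<lambda>w. Q (fst_part k w) (n, U, p) (snd_part k w))"
  shows "(k, U', Q) \<in> form_diff m D"
  using assms unfolding form_diff_def by auto

lemma smooth_into_alt_cong:
  assumes "domain d U" and "smooth_into_alt m n d U \<eta>'" and "\<And>u. u \<in> U \<Longrightarrow> \<eta> u = \<eta>' u"
  shows "smooth_into_alt m n d U \<eta>"
  by (rule smooth_into_alt_locally) (use assms in blast)

lemma form_diff_pullback:
  assumes A: "diffeology_on A DA" and g: "diff_smooth A DA B DB g"
    and Q: "(k, U', Q) \<in> form_diff m DB"
  shows "(k, U', compose U' (form_pullback DA g) Q) \<in> form_diff m DA"
proof (rule form_diffI)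
  show "domain k U'"
    by (rule form_diff_plot(1)[OF Q])
  show "compose U' (form_pullback DA g) Q \<in> U' \<rightarrow>\<^sub>E forms m DA"
    using form_diff_plot(2)[OF Q] form_pullback_in_forms[OF A g] by (auto simp: compose_def)
  fix n U p assume p: "(n, U, p) \<in> DA"
  show "smooth_into_alt m n (k + n) (prod_domain k n U' U)
       (\<lambda>w. compose U' (form_pullback DA g) Q (fst_part k w) (n, U, p) (snd_part k w))"
  proof (rule smooth_into_alt_cong)
    show "domain (k + n) (prod_domain k n U' U)"
      by (intro domain_prod_domain form_diff_plot(1)[OF Q] diffeology_on_domain[OF A p])
    show "smooth_into_alt m n (k + n) (prod_domain k n U' U)
       (\<lambda>w. Q (fst_part k w) (n, U, compose U g p) (snd_part k w))"
      by (rule form_diff_plot(3)[OF Q diff_smoothD[OF g p]])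
  qed (use p in \<open>auto simp: prod_domain_def compose_def form_pullback_def\<close>)
qed

text \<open>The lift concerns only the plot variable, so one lift works for all parameters: near
  \<open>w\<close> the family is computed on the whole of \<open>U'\<close> times a neighbourhood
  \<open>V\<close>.\<close>

lemma form_diff_descend:
  assumes A: "diffeology_on A DA" and B: "diffeology_on B DB" and g: "subduction A DA B DB g"
    and Q: "(k, U', Q) \<in> form_diff m DA" and basic: "\<And>x. x \<in> U' \<Longrightarrow> Q x \<in> basic_forms m DA g"
  shows "(k, U', compose U' (descend DA DB g) Q) \<in> form_diff m DB"
proof (rule form_diffI)
  show U': "domain k U'"
    by (rule form_diff_plot(1)[OF Q])
  show "compose U' (descend DA DB g) Q \<in> U' \<rightarrow>\<^sub>E forms m DB"
    using descend_in_forms[OF A B g basic] by (auto simp: compose_def)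
  fix n U p assume p: "(n, U, p) \<in> DB"
  show "smooth_into_alt m n (k + n) (prod_domain k n U' U)
       (\<lambda>w. compose U' (descend DA DB g) Q (fst_part k w) (n, U, p) (snd_part k w))"
  proof (rule smooth_into_alt_locally)
    fix w assume w: "w \<in> prod_domain k n U' U"
    then have "snd_part k w \<in> U"
      by (simp add: prod_domain_def)
    from subduction_local_lift[OF g p this]
    obtain V q where q: "local_lift DA g n U p (snd_part k w) V q"
      by blast
    then have V: "domain n V" "snd_part k w \<in> V" "V \<subseteq> U" "(n, V, q) \<in> DA"
      by (auto simp: local_lift_def)
    have "compose U' (descend DA DB g) Q (fst_part k x) (n, U, p) (snd_part k x) =
        Q (fst_part k x) (n, V, q) (snd_part k x)" if "x \<in> prod_domain k n U' V" for x
    proof -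
      have x: "fst_part k x \<in> U'" "snd_part k x \<in> V"
        using that by (auto simp: prod_domain_def)
      show ?thesis
        using descend_eq[OF A basic[OF x(1)] p local_lift_mono[OF q x(2)]] x(1)
        by (simp add: compose_def)
    qed
    moreover have "w \<in> prod_domain k n U' V" "prod_domain k n U' V \<subseteq> prod_domain k n U' U"
      using w V by (auto simp: prod_domain_def)
    ultimately show "\<exists>N \<eta>'. domain (k + n) N \<and> w \<in> N \<and> N \<subseteq> prod_domain k n U' U \<and>
        smooth_into_alt m n (k + n) N \<eta>' \<and>
        (\<forall>x\<in>N. compose U' (descend DA DB g) Q (fst_part k x) (n, U, p) (snd_part k x) = \<eta>' x)"
      using domain_prod_domain[OF U' V(1)] form_diff_plot(3)[OF Q V(4)]
      by (intro exI[of _ "prod_domain k n U' V"]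
          exI[of _ "\<lambda>x. Q (fst_part k x) (n, V, q) (snd_part k x)"]) simp
  qed
qed

section \<open>Pushforwards\<close>

text \<open>The coarsest diffeology. It witnesses that the families whose intersections define
  pushforwards and sums are nonempty.\<close>

definition indiscrete_diff :: "'a set \<Rightarrow> 'a plot set"
  where "indiscrete_diff X = {(n, U, p). domain n U \<and> p \<in> U \<rightarrow>\<^sub>E X}"

lemma diffeology_on_indiscrete: "diffeology_on X (indiscrete_diff X)"
  by (rule diffeology_onI)
    (auto simp: indiscrete_diff_def compose_def smooth_between_def PiE_def)

lemma diff_smooth_indiscrete:
  assumes "diffeology_on A DA" and "h \<in> A \<rightarrow> B"
  shows "diff_smooth A DA B (indiscrete_diff B) h"
  unfolding diff_smooth_def
proof (intro conjI ballI, rule assms(2), clarify)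
  fix n U p assume "(n, U, p) \<in> DA"
  from diffeology_on_domain[OF assms(1) this] diffeology_on_typed[OF assms(1) this] assms(2)
  show "(n, U, compose U h p) \<in> indiscrete_diff B"
    by (auto simp: indiscrete_diff_def compose_def)
qed

text \<open>Each axiom passes to intersections. The empty family is excluded by \<open>ne\<close>,
  as its intersection would contain every triple, open domain or not.\<close>

lemma diffeology_on_Inter:
  assumes ne: "\<D> \<noteq> {}" and D: "\<And>D. D \<in> \<D> \<Longrightarrow> diffeology_on X D"
  shows "diffeology_on X (\<Inter>\<D>)"
proof -
  obtain D0 where D0: "D0 \<in> \<D>"
    using ne by blast
  show ?thesis
  proof (rule diffeology_onI)
    fix n U p assume p: "(n, U, p) \<in> \<Inter>\<D>"
    then have "(n, U, p) \<in> D0"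
      using D0 by blast
    then show "domain n U" "p \<in> U \<rightarrow>\<^sub>E X"
      using diffeology_on_domain[OF D[OF D0]] diffeology_on_typed[OF D[OF D0]] by auto
    show "(n', U', compose U' p F) \<in> \<Inter>\<D>" if "smooth_between n' U' n U F" for n' U' F
      by (intro InterI diffeology_on_compose[OF D _ that]) (use p in auto)
  next
    fix n U x assume "domain n U" "x \<in> X"
    then show "(n, U, \<lambda>u\<in>U. x) \<in> \<Inter>\<D>"
      by (intro InterI diffeology_on_const[OF D])
  next
    fix n U p
    assume p: "domain n U" "p \<in> U \<rightarrow>\<^sub>E X"
      and loc: "\<And>u. u \<in> U \<Longrightarrow> \<exists>V. domain n V \<and> u \<in> V \<and> V \<subseteq> U \<and> (n, V, restrict p V) \<in> \<Inter>\<D>"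
    show "(n, U, p) \<in> \<Inter>\<D>"
    proof (rule InterI)
      fix D' assume D': "D' \<in> \<D>"
      show "(n, U, p) \<in> D'"
      proof (rule diffeology_on_locally[OF D[OF D'] p])
        fix u assume "u \<in> U"
        from loc[OF this] D' show "\<exists>V. domain n V \<and> u \<in> V \<and> V \<subseteq> U \<and> (n, V, restrict p V) \<in> D'"
          by blast
      qed
    qed
  qed
qed

lemma diffeology_on_pushforward:
  assumes "diffeology_on A DA" and "h \<in> A \<rightarrow> B"
  shows "diffeology_on B (pushforward A DA B h)"
  unfolding pushforward_def
  using diff_smooth_indiscrete[OF assms] diffeology_on_indiscrete[of B]
  by (intro diffeology_on_Inter) auto

lemma pushforward_plot: "(n, U, p) \<in> DA \<Longrightarrow> (n, U, compose U h p) \<in> pushforward A DA B h"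
  by (auto simp: pushforward_def diff_smooth_def)

lemma pushforward_least:
  "diffeology_on B DB \<Longrightarrow> diff_smooth A DA B DB h \<Longrightarrow> pushforward A DA B h \<subseteq> DB"
  by (auto simp: pushforward_def)

text \<open>A pushforward depends only on which diffeologies make the map smooth, so two of them are
  compared by testing smoothness into an arbitrary diffeology.\<close>

lemma pushforward_cong:
  assumes "\<And>D. diffeology_on C D \<Longrightarrow> diff_smooth A DA C D h \<longleftrightarrow> diff_smooth B DB C D k"
  shows "pushforward A DA C h = pushforward B DB C k"
  unfolding pushforward_def using assms by (intro arg_cong[of _ _ Inter]) blast

lemma diff_smoothI:
  "f \<in> A \<rightarrow> B \<Longrightarrow> (\<And>n U p. (n, U, p) \<in> DA \<Longrightarrow> (n, U, compose U f p) \<in> DB) \<Longrightarrow>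
   diff_smooth A DA B DB f"
  by (auto simp: diff_smooth_def)

lemma diff_smooth_comp:
  assumes "diff_smooth A DA B DB g" and "diff_smooth B DB C DC h"
  shows "diff_smooth A DA C DC (h \<circ> g)"
proof (rule diff_smoothI)
  show "h \<circ> g \<in> A \<rightarrow> C"
    using assms by (auto simp: diff_smooth_def)
  fix n U p assume "(n, U, p) \<in> DA"
  from diff_smoothD[OF assms(2) diff_smoothD[OF assms(1) this]]
  show "(n, U, compose U (h \<circ> g) p) \<in> DC"
    by (simp add: compose_def cong: restrict_cong)
qed

section \<open>Comparison of pushforwards\<close>

text \<open>Every plot of \<open>B\<close> lifts along \<open>\<phi>\<close> on its whole domain, so
  \<open>\<kappa>\<close> and \<open>\<psi>\<close> are smooth into the same diffeologies. Meant for
  \<open>\<phi>\<close> the pullback along \<open>\<alpha>1\<close>, with lifts given by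
  \<open>descend\<close>.\<close>

lemma pushforward_comp_lift:
  assumes \<phi>: "\<phi> ` A = B"
    and plots: "\<And>n U p. (n, U, p) \<in> DA \<Longrightarrow> p ` U \<subseteq> A \<and> (n, U, compose U \<phi> p) \<in> DB"
    and lift: "\<And>n U p. (n, U, p) \<in> DB \<Longrightarrow> \<exists>q. (n, U, q) \<in> DA \<and> compose U \<phi> q = p"
    and \<kappa>: "\<And>a. a \<in> A \<Longrightarrow> \<kappa> a = \<psi> (\<phi> a)"
  shows "pushforward A DA C \<kappa> = pushforward B DB C \<psi>"
proof (rule pushforward_cong)
  fix D
  have eq: "compose U \<kappa> p = compose U \<psi> (compose U \<phi> p)" if "(n, U, p) \<in> DA" for n U p
    using plots[OF that] \<kappa> unfolding compose_def by (intro restrict_ext) auto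
  have funcset: "\<kappa> \<in> A \<rightarrow> C \<longleftrightarrow> \<psi> \<in> B \<rightarrow> C"
    unfolding \<phi>[symmetric] by (simp add: Pi_iff \<kappa>)
  show "diff_smooth A DA C D \<kappa> \<longleftrightarrow> diff_smooth B DB C D \<psi>"
  proof
    assume *: "diff_smooth A DA C D \<kappa>"
    show "diff_smooth B DB C D \<psi>"
    proof (rule diff_smoothI)
      show "\<psi> \<in> B \<rightarrow> C"
        using * funcset by (simp add: diff_smooth_def)
      fix n U p assume "(n, U, p) \<in> DB"
      from lift[OF this] obtain q where "(n, U, q) \<in> DA" "compose U \<phi> q = p"
        by blast
      then show "(n, U, compose U \<psi> p) \<in> D"
        using diff_smoothD[OF *] eq by metis
    qed
  next
    assume *: "diff_smooth B DB C D \<psi>"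
    show "diff_smooth A DA C D \<kappa>"
    proof (rule diff_smoothI)
      show "\<kappa> \<in> A \<rightarrow> C"
        using * funcset by (simp add: diff_smooth_def)
      fix n U p assume p: "(n, U, p) \<in> DA"
      with plots have "(n, U, compose U \<phi> p) \<in> DB"
        by blast
      from diff_smoothD[OF * this] show "(n, U, compose U \<kappa> p) \<in> D"
        by (simp add: eq[OF p])
    qed
  qed
qed

text \<open>The alternative of local constancy is there because every diffeology contains the constant
  maps, even those with values outside the image of \<open>\<phi>\<close>.\<close>

definition transfer_diff ::
  "'a set \<Rightarrow> ('a \<Rightarrow> 'b) \<Rightarrow> 'b set \<Rightarrow> ('a \<Rightarrow> 'c) \<Rightarrow> 'c plot set \<Rightarrow> 'b plot set"
  where "transfer_diff B \<phi> C \<psi> E = {(n, U, p). domain n U \<and> p \<in> U \<rightarrow>\<^sub>E C \<and>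
    (\<forall>u\<in>U. \<exists>V. domain n V \<and> u \<in> V \<and> V \<subseteq> U \<and>
      ((\<exists>c. \<forall>v\<in>V. p v = c) \<or>
       (\<exists>r \<in> V \<rightarrow> B. (\<forall>v\<in>V. p v = \<phi> (r v)) \<and> (n, V, compose V \<psi> r) \<in> E)))}"

lemma diffeology_on_transfer_diff:
  assumes E: "diffeology_on C' E"
  shows "diffeology_on C (transfer_diff B \<phi> C \<psi> E)"
proof (rule diffeology_onI)
  fix n U p assume p: "(n, U, p) \<in> transfer_diff B \<phi> C \<psi> E"
  then show "domain n U" and C: "p \<in> U \<rightarrow>\<^sub>E C"
    by (auto simp: transfer_diff_def)
  fix n' U' F assume F: "smooth_between n' U' n U F"
  then have F': "domain n' U'" "F \<in> U' \<rightarrow> U"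
    by (auto simp: smooth_between_def)
  have "\<exists>V. domain n' V \<and> u \<in> V \<and> V \<subseteq> U' \<and>
      ((\<exists>c. \<forall>v\<in>V. compose U' p F v = c) \<or>
       (\<exists>r \<in> V \<rightarrow> B. (\<forall>v\<in>V. compose U' p F v = \<phi> (r v)) \<and> (n', V, compose V \<psi> r) \<in> E))"
    if u: "u \<in> U'" for u
  proof -
    have "F u \<in> U"
      using F' u by blast
    then obtain V where V: "domain n V" "F u \<in> V" "V \<subseteq> U"
      and *: "(\<exists>c. \<forall>v\<in>V. p v = c) \<or>
       (\<exists>r \<in> V \<rightarrow> B. (\<forall>v\<in>V. p v = \<phi> (r v)) \<and> (n, V, compose V \<psi> r) \<in> E)"
      using p unfolding transfer_diff_def by blast
    define V' where "V' = {x \<in> U'. F x \<in> V}"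
    have V': "domain n' V'" "u \<in> V'" "V' \<subseteq> U'" "F ` V' \<subseteq> V"
      using domain_vimage[OF F V(1)] u V(2) by (auto simp: V'_def)
    have pF: "compose U' p F v = p (F v)" "F v \<in> V" if "v \<in> V'" for v
      using that V' by (auto simp: compose_def)
    from * have "(\<exists>c. \<forall>v\<in>V'. compose U' p F v = c) \<or>
       (\<exists>r \<in> V' \<rightarrow> B. (\<forall>v\<in>V'. compose U' p F v = \<phi> (r v)) \<and> (n', V', compose V' \<psi> r) \<in> E)"
    proof (elim disjE bexE conjE)
      assume "\<exists>c. \<forall>v\<in>V. p v = c"
      then show ?thesis
        using pF by auto
    next
      fix r assume r: "r \<in> V \<rightarrow> B" "\<forall>v\<in>V. p v = \<phi> (r v)" "(n, V, compose V \<psi> r) \<in> E"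
      have "(n', V', compose V' (compose V \<psi> r) F) \<in> E"
        by (rule diffeology_on_compose[OF E r(3) smooth_between_restrict[OF F V'(1,3) V(1) V'(4)]])
      also have "compose V' (compose V \<psi> r) F = compose V' \<psi> (r \<circ> F)"
        using pF unfolding compose_def by (intro restrict_ext) simp
      finally have "(n', V', compose V' \<psi> (r \<circ> F)) \<in> E" .
      moreover have "r \<circ> F \<in> V' \<rightarrow> B" "\<forall>v\<in>V'. compose U' p F v = \<phi> ((r \<circ> F) v)"
        using r pF by auto
      ultimately show ?thesis
        by blast
    qed
    with V'(1-3) show ?thesis
      by blast
  qed
  moreover have "compose U' p F \<in> U' \<rightarrow>\<^sub>E C"
    using C F' by (auto simp: compose_def)
  ultimately show "(n', U', compose U' p F) \<in> transfer_diff B \<phi> C \<psi> E"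
    using F'(1) unfolding transfer_diff_def by simp
next
  fix n U x assume "domain n U" "x \<in> C"
  then show "(n, U, \<lambda>u\<in>U. x) \<in> transfer_diff B \<phi> C \<psi> E"
    unfolding transfer_diff_def by auto
next
  fix n U p
  assume U: "domain n U" and p: "p \<in> U \<rightarrow>\<^sub>E C"
    and loc: "\<And>u. u \<in> U \<Longrightarrow> \<exists>V. domain n V \<and> u \<in> V \<and> V \<subseteq> U \<and>
      (n, V, restrict p V) \<in> transfer_diff B \<phi> C \<psi> E"
  have "\<exists>V. domain n V \<and> u \<in> V \<and> V \<subseteq> U \<and>
      ((\<exists>c. \<forall>v\<in>V. p v = c) \<or>
       (\<exists>r \<in> V \<rightarrow> B. (\<forall>v\<in>V. p v = \<phi> (r v)) \<and> (n, V, compose V \<psi> r) \<in> E))" if "u \<in> U" for u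
  proof -
    from loc[OF that] obtain V' where V': "V' \<subseteq> U" "u \<in> V'"
      "(n, V', restrict p V') \<in> transfer_diff B \<phi> C \<psi> E"
      by blast
    from V'(2,3) obtain V where V: "domain n V" "u \<in> V" "V \<subseteq> V'"
      and *: "(\<exists>c. \<forall>v\<in>V. restrict p V' v = c) \<or>
       (\<exists>r \<in> V \<rightarrow> B. (\<forall>v\<in>V. restrict p V' v = \<phi> (r v)) \<and> (n, V, compose V \<psi> r) \<in> E)"
      unfolding transfer_diff_def by blast
    have "restrict p V' v = p v" if "v \<in> V" for v
      using that V(3) by auto
    with * have "(\<exists>c. \<forall>v\<in>V. p v = c) \<or>
       (\<exists>r \<in> V \<rightarrow> B. (\<forall>v\<in>V. p v = \<phi> (r v)) \<and> (n, V, compose V \<psi> r) \<in> E)"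
      by simp
    with V V'(1) show ?thesis
      by blast
  qed
  with U p show "(n, U, p) \<in> transfer_diff B \<phi> C \<psi> E"
    unfolding transfer_diff_def by simp
qed

text \<open>The pushforward lies in \<open>transfer_diff\<close> by minimality, and injectivity of
  \<open>\<phi>\<close> recovers \<open>q\<close> locally from its image. Thus what holds in
  \<open>E\<close> for the families \<open>r\<close> matching plots of \<open>DA\<close> extends to
  every \<open>q\<close> whose image under \<open>\<phi>\<close> is a plot of the
  pushforward.\<close>

lemma pushforward_transfer:
  assumes E: "diffeology_on C' E" and \<phi>: "inj_on \<phi> B" and \<psi>: "\<psi> \<in> B \<rightarrow> C'"
    and \<theta>: "\<theta> \<in> A \<rightarrow> C"
    and DA: "\<And>n U p. (n, U, p) \<in> DA \<Longrightarrow> domain n U \<and> p ` U \<subseteq> A \<and>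
      (\<exists>r \<in> U \<rightarrow> B. (\<forall>u\<in>U. \<theta> (p u) = \<phi> (r u)) \<and> (n, U, compose U \<psi> r) \<in> E)"
    and U: "domain n U" and q: "q \<in> U \<rightarrow> B"
    and push: "(n, U, compose U \<phi> q) \<in> pushforward A DA C \<theta>"
  shows "(n, U, compose U \<psi> q) \<in> E"
proof -
  have "pushforward A DA C \<theta> \<subseteq> transfer_diff B \<phi> C \<psi> E"
  proof (rule pushforward_least[OF diffeology_on_transfer_diff[OF E]], rule diff_smoothI[OF \<theta>])
    fix n U p assume "(n, U, p) \<in> DA"
    from DA[OF this] obtain r where p: "domain n U" "p ` U \<subseteq> A"
      and r: "r \<in> U \<rightarrow> B" "\<forall>u\<in>U. \<theta> (p u) = \<phi> (r u)" "(n, U, compose U \<psi> r) \<in> E"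
      by blast
    have "\<forall>u\<in>U. compose U \<theta> p u = \<phi> (r u)"
      using r(2) by (simp add: compose_def)
    moreover have "compose U \<theta> p \<in> U \<rightarrow>\<^sub>E C"
      using p(2) \<theta> by (auto simp: compose_def)
    ultimately show "(n, U, compose U \<theta> p) \<in> transfer_diff B \<phi> C \<psi> E"
      using p(1) r(1,3) unfolding transfer_diff_def by blast
  qed
  with push have q': "(n, U, compose U \<phi> q) \<in> transfer_diff B \<phi> C \<psi> E"
    by blast
  show ?thesis
  proof (rule diffeology_on_locally[OF E U])
    show "compose U \<psi> q \<in> U \<rightarrow>\<^sub>E C'"
      using q \<psi> by (auto simp: compose_def)
    fix u assume "u \<in> U"
    with q' obtain V where V: "domain n V" "u \<in> V" "V \<subseteq> U"
      and *: "(\<exists>c. \<forall>v\<in>V. compose U \<phi> q v = c) \<or>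
       (\<exists>r \<in> V \<rightarrow> B. (\<forall>v\<in>V. compose U \<phi> q v = \<phi> (r v)) \<and> (n, V, compose V \<psi> r) \<in> E)"
      unfolding transfer_diff_def by blast
    have \<phi>q: "compose U \<phi> q v = \<phi> (q v)" "q v \<in> B" if "v \<in> V" for v
      using that V(3) q by (auto simp: compose_def)
    have \<psi>q: "restrict (compose U \<psi> q) V = compose V \<psi> q"
      using V(3) by (auto simp: compose_def fun_eq_iff)
    from * have "(n, V, compose V \<psi> q) \<in> E"
    proof (elim disjE bexE conjE exE)
      \<comment> \<open>As \<open>\<phi>\<close> is injective on \<open>B\<close>, \<open>q\<close>
        is constant on \<open>V\<close>, and \<open>E\<close> contains constant plots.\<close>
      fix c assume "\<forall>v\<in>V. compose U \<phi> q v = c"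
      then have "q v = q u" if "v \<in> V" for v
        using that V(2) \<phi>q inj_onD[OF \<phi>] by metis
      then have "compose V \<psi> q = (\<lambda>v\<in>V. \<psi> (q u))"
        unfolding compose_def by (intro restrict_ext) simp
      moreover have "(n, V, \<lambda>v\<in>V. \<psi> (q u)) \<in> E"
        using \<psi> \<phi>q(2)[OF V(2)] by (intro diffeology_on_const[OF E V(1)]) auto
      ultimately show ?thesis
        by simp
    next
      fix r assume r: "r \<in> V \<rightarrow> B" "\<forall>v\<in>V. compose U \<phi> q v = \<phi> (r v)" "(n, V, compose V \<psi> r) \<in> E"
      have "q v = r v" if "v \<in> V" for v
        using that \<phi>q r(1,2) by (intro inj_onD[OF \<phi>]) auto
      then have "compose V \<psi> q = compose V \<psi> r"
        unfolding compose_def by (intro restrict_ext) simp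
      with r(3) show ?thesis
        by simp
    qed
    with V \<psi>q show "\<exists>V. domain n V \<and> u \<in> V \<and> V \<subseteq> U \<and> (n, V, restrict (compose U \<psi> q) V) \<in> E"
      by (intro exI[of _ V]) simp
  qed
qed

text \<open>Restricting to the image of \<open>h\<close> and then pulling back composes to the
  pullback along \<open>h\<close>.\<close>

lemma image_diff_eq:
  assumes "diff_smooth S (sub_diff S D) Z DZ h"
  shows "image_diff m D S h DZ \<Omega> = pushforward \<Omega> (sub_diff \<Omega> (form_diff m DZ))
    (forms m (sub_diff S D)) (form_pullback (sub_diff S D) h)"
proof -
  have "form_pullback (sub_diff S D) h (form_pullback (sub_diff (h ` S) DZ) (\<lambda>x. x) \<omega>) =
      form_pullback (sub_diff S D) ((\<lambda>x. x) \<circ> h) \<omega>" for \<omega>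
    by (rule form_pullback_comp, rule sub_diff_image[OF assms]) (auto simp: sub_diff_def)
  then show ?thesis
    by (simp add: image_diff_def comp_def)
qed

section \<open>Gluing\<close>

text \<open>Candidate for the pushforward along a surjection \<open>g\<close>; it bounds the plots
  of the glued space from above.\<close>

definition lifted_diff :: "'a plot set \<Rightarrow> 'b set \<Rightarrow> ('a \<Rightarrow> 'b) \<Rightarrow> 'b plot set"
  where "lifted_diff DA B g = {(n, U, p). domain n U \<and> p \<in> U \<rightarrow>\<^sub>E B \<and>
    (\<forall>u\<in>U. \<exists>V q. local_lift DA g n U p u V q)}"

lemma diffeology_on_lifted_diff:
  assumes A: "diffeology_on A DA" and g: "g ` A = B"
  shows "diffeology_on B (lifted_diff DA B g)"
proof (rule diffeology_onI)
  fix n U p assume p: "(n, U, p) \<in> lifted_diff DA B g"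
  then show "domain n U" and B: "p \<in> U \<rightarrow>\<^sub>E B"
    by (auto simp: lifted_diff_def)
  fix n' U' F assume F: "smooth_between n' U' n U F"
  then have F': "domain n' U'" "F \<in> U' \<rightarrow> U"
    by (auto simp: smooth_between_def)
  have "\<exists>V q. local_lift DA g n' U' (compose U' p F) u V q" if u: "u \<in> U'" for u
  proof -
    have "F u \<in> U"
      using F' u by blast
    then obtain V q where "local_lift DA g n U p (F u) V q"
      using p unfolding lifted_diff_def by blast
    from local_lift_compose(1)[OF A this F u refl] show ?thesis
      by blast
  qed
  moreover have "compose U' p F \<in> U' \<rightarrow>\<^sub>E B"
    using B F' by (auto simp: compose_def)
  ultimately show "(n', U', compose U' p F) \<in> lifted_diff DA B g"
    using F'(1) by (simp add: lifted_diff_def)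
next
  fix n U x assume U: "domain n U" and x: "x \<in> B"
  \<comment> \<open>Surjectivity of \<open>g\<close> makes constant maps liftable.\<close>
  obtain a where a: "a \<in> A" "x = g a"
    using x g by blast
  have "restrict (\<lambda>u\<in>U. x) U = compose U g (\<lambda>u\<in>U. a)"
    by (simp add: a(2) compose_def fun_eq_iff)
  then have "local_lift DA g n U (\<lambda>u\<in>U. x) u U (\<lambda>u\<in>U. a)" if "u \<in> U" for u
    using diffeology_on_const[OF A U a(1)] U that unfolding local_lift_def by blast
  with U x show "(n, U, \<lambda>u\<in>U. x) \<in> lifted_diff DA B g"
    unfolding lifted_diff_def by auto
next
  fix n U p
  assume U: "domain n U" and p: "p \<in> U \<rightarrow>\<^sub>E B"
    and loc: "\<And>u. u \<in> U \<Longrightarrow> \<exists>V. domain n V \<and> u \<in> V \<and> V \<subseteq> U \<and> (n, V, restrict p V) \<in> lifted_diff DA B g"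
  have "\<exists>V q. local_lift DA g n U p u V q" if "u \<in> U" for u
  proof -
    from loc[OF that] obtain V where V: "V \<subseteq> U" "u \<in> V" "(n, V, restrict p V) \<in> lifted_diff DA B g"
      by blast
    then obtain N q where N: "local_lift DA g n V (restrict p V) u N q"
      unfolding lifted_diff_def by blast
    then have "restrict (restrict p V) N = restrict p N"
      by (auto simp: local_lift_def Int_absorb1)
    with N V(1) have "local_lift DA g n U p u N q"
      by (auto simp: local_lift_def)
    then show ?thesis
      by blast
  qed
  with U p show "(n, U, p) \<in> lifted_diff DA B g"
    by (simp add: lifted_diff_def)
qed

text \<open>The inverse image diffeology. It turns a diffeology on the glued space into one on the
  disjoint union.\<close>

lemma diffeology_on_vimage:
  assumes B: "diffeology_on B DB" and g: "g \<in> A \<rightarrow> B"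
  shows "diffeology_on A {(n, U, p). p \<in> U \<rightarrow>\<^sub>E A \<and> (n, U, compose U g p) \<in> DB}" (is "diffeology_on A ?D")
proof (rule diffeology_onI)
  fix n U p assume "(n, U, p) \<in> ?D"
  then have p: "p \<in> U \<rightarrow>\<^sub>E A" "(n, U, compose U g p) \<in> DB"
    by auto
  show "domain n U" "p \<in> U \<rightarrow>\<^sub>E A"
    using p diffeology_on_domain[OF B] by auto
  fix n' U' F assume F: "smooth_between n' U' n U F"
  then have F': "F \<in> U' \<rightarrow> U"
    by (simp add: smooth_between_def)
  have "compose U' p F \<in> U' \<rightarrow>\<^sub>E A"
    using p(1) F' by (auto simp: compose_def)
  then show "(n', U', compose U' p F) \<in> ?D"
    using diffeology_on_compose[OF B p(2) F] compose_assoc[OF F', of g p] by simp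
next
  fix n U x assume U: "domain n U" and x: "x \<in> A"
  have "compose U g (\<lambda>u\<in>U. x) = (\<lambda>u\<in>U. g x)"
    by (simp add: compose_def fun_eq_iff)
  with x g diffeology_on_const[OF B U, of "g x"] show "(n, U, \<lambda>u\<in>U. x) \<in> ?D"
    by auto
next
  fix n U p
  assume U: "domain n U" and p: "p \<in> U \<rightarrow>\<^sub>E A"
    and loc: "\<And>u. u \<in> U \<Longrightarrow> \<exists>V. domain n V \<and> u \<in> V \<and> V \<subseteq> U \<and> (n, V, restrict p V) \<in> ?D"
  have "(n, U, compose U g p) \<in> DB"
  proof (rule diffeology_on_locally[OF B U])
    show "compose U g p \<in> U \<rightarrow>\<^sub>E B"
      using p g by (auto simp: compose_def)
    fix u assume "u \<in> U"
    from loc[OF this] obtain V where V: "domain n V" "u \<in> V" "V \<subseteq> U"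
      "(n, V, compose V g (restrict p V)) \<in> DB"
      by blast
    moreover have "compose V g (restrict p V) = restrict (compose U g p) V"
      using V(3) by (auto simp: compose_def fun_eq_iff)
    ultimately show "\<exists>V. domain n V \<and> u \<in> V \<and> V \<subseteq> U \<and> (n, V, restrict (compose U g p) V) \<in> DB"
      by (intro exI[of _ V]) simp
  qed
  with p show "(n, U, p) \<in> ?D"
    by simp
qed

text \<open>A point of \<open>B\<close> is a constant plot on the one-point domain
  \<open>Rn 0\<close>, and lifting that plot yields a preimage.\<close>

lemma subduction_image:
  assumes A: "diffeology_on A DA" and B: "diffeology_on B DB" and g: "subduction A DA B DB g"
  shows "g ` A = B"
proof
  show "g ` A \<subseteq> B"
    using g by (auto simp: subduction_def diff_smooth_def)
  show "B \<subseteq> g ` A"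
  proof
    fix x assume x: "x \<in> B"
    have "(0, Rn 0, \<lambda>u\<in>Rn 0. x) \<in> DB"
      by (rule diffeology_on_const[OF B openin_topspace x])
    moreover have u: "(\<lambda>i. 0) \<in> Rn 0"
      by (simp add: topspace_Euclidean_space)
    ultimately obtain V q where q: "local_lift DA g 0 (Rn 0) (\<lambda>u\<in>Rn 0. x) (\<lambda>i. 0) V q"
      using subduction_local_lift[OF g] by blast
    then have V: "(\<lambda>i. 0) \<in> V" "(0, V, q) \<in> DA"
      by (auto simp: local_lift_def)
    have "x = g (q (\<lambda>i. 0))"
      using local_lift_eq[OF q V(1)] u by simp
    moreover have "q (\<lambda>i. 0) \<in> A"
      using diffeology_on_typed[OF A V(2)] V(1) by auto
    ultimately show "x \<in> g ` A"
      by blast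
  qed
qed

section \<open>The gluing relation and the glued space\<close>

text \<open>Canonical representative of a glued point. One move suffices, since \<open>f\<close>
  lands in the other summand.\<close>

fun glue_normal :: "'a set \<Rightarrow> ('a \<Rightarrow> 'b) \<Rightarrow> 'a + 'b \<Rightarrow> 'a + 'b" where
  "glue_normal Y f (Inl x) = (if x \<in> Y then Inr (f x) else Inl x)"
| "glue_normal Y f (Inr z) = Inr z"

text \<open>Having the same representative is an equivalence containing the generators; conversely
  every such equivalence links a point to its representative.\<close>

lemma glue_rel_eq:
  assumes Y: "Y \<subseteq> X1" and f: "f \<in> Y \<rightarrow> X2"
  shows "glue_rel X1 X2 Y f =
    {(a, b). a \<in> X1 <+> X2 \<and> b \<in> X1 <+> X2 \<and> glue_normal Y f a = glue_normal Y f b}" (is "_ = ?R")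
proof
  have "equiv (X1 <+> X2) ?R"
    by (intro equivI refl_onI symI transI) auto
  moreover have "\<forall>y\<in>Y. (Inl y, Inr (f y)) \<in> ?R"
    using Y f by auto
  ultimately show "glue_rel X1 X2 Y f \<subseteq> ?R"
    unfolding glue_rel_def by blast
  show "?R \<subseteq> glue_rel X1 X2 Y f"
    unfolding glue_rel_def
  proof (intro Inter_greatest, clarify)
    fix R a b
    assume R: "equiv (X1 <+> X2) R" "\<forall>y\<in>Y. (Inl y, Inr (f y)) \<in> R"
      and ab: "a \<in> X1 <+> X2" "b \<in> X1 <+> X2" "glue_normal Y f a = glue_normal Y f b"
    \<comment> \<open>A single generator for points of \<open>Y\<close>, reflexivity for all
      others.\<close>
    have norm: "(c, glue_normal Y f c) \<in> R" if "c \<in> X1 <+> X2" for c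
      using that R equiv_class_self[OF R(1) that] by (cases c) auto
    have "(glue_normal Y f a, b) \<in> R"
      using norm[OF ab(2)] ab(3) R(1) by (metis equivE symE)
    with norm[OF ab(1)] R(1) show "(a, b) \<in> R"
      by (meson equivE transE)
  qed
qed

locale gluing =
  fixes X1 :: "'a set" and D1 :: "'a plot set" and X2 :: "'b set" and D2 :: "'b plot set"
    and Y :: "'a set" and f :: "'a \<Rightarrow> 'b"
  assumes X1: "diffeology_on X1 D1" and X2: "diffeology_on X2 D2" and Y: "Y \<subseteq> X1"
    and f: "subduction Y (sub_diff Y D1) X2 D2 f"
begin

abbreviation "G \<equiv> (X1 <+> X2) // glue_rel X1 X2 Y f"
abbreviation "DG \<equiv> glue_diff X1 D1 X2 D2 Y f"
abbreviation "\<alpha>1 \<equiv> glue_inl X1 X2 Y f"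
abbreviation "\<alpha>2 \<equiv> glue_inr X1 X2 Y f"
abbreviation "\<pi> \<equiv> \<lambda>x. glue_rel X1 X2 Y f `` {x}"

lemma DY: "diffeology_on Y (sub_diff Y D1)"
  by (rule diffeology_on_sub_diff[OF X1 Y])

lemma f_image: "f ` Y = X2"
  by (rule subduction_image[OF DY X2 f])

lemma f_funcset: "f \<in> Y \<rightarrow> X2"
  using f_image by blast

lemma f_smooth: "diff_smooth Y (sub_diff Y D1) X2 D2 f"
  using f by (simp add: subduction_def)

lemma \<pi>_eq_iff:
  assumes "a \<in> X1 <+> X2" and "b \<in> X1 <+> X2"
  shows "\<pi> a = \<pi> b \<longleftrightarrow> glue_normal Y f a = glue_normal Y f b"
proof -
  have \<pi>: "\<pi> c = {d \<in> X1 <+> X2. glue_normal Y f c = glue_normal Y f d}" if "c \<in> X1 <+> X2" for c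
    using that unfolding glue_rel_eq[OF Y f_funcset] by blast
  show ?thesis
    unfolding \<pi>[OF assms(1)] \<pi>[OF assms(2)]
  proof
    assume "{d \<in> X1 <+> X2. glue_normal Y f a = glue_normal Y f d} =
      {d \<in> X1 <+> X2. glue_normal Y f b = glue_normal Y f d}"
    from eqset_imp_iff[OF this, of b] assms(2) show "glue_normal Y f a = glue_normal Y f b"
      by simp
  qed simp
qed

lemma \<alpha>1_eq_iff:
  assumes "x \<in> X1" and "x' \<in> X1"
  shows "\<alpha>1 x = \<alpha>1 x' \<longleftrightarrow> x = x' \<or> x \<in> Y \<and> x' \<in> Y \<and> f x = f x'"
  unfolding glue_inl_def \<pi>_eq_iff[OF InlI[OF assms(1)] InlI[OF assms(2)]] by auto

lemma \<alpha>2_eq_iff: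
  assumes "z \<in> X2" and "z' \<in> X2"
  shows "\<alpha>2 z = \<alpha>2 z' \<longleftrightarrow> z = z'"
  unfolding glue_inr_def \<pi>_eq_iff[OF InrI[OF assms(1)] InrI[OF assms(2)]] by simp

lemma \<alpha>2_f:
  assumes "y \<in> Y"
  shows "\<alpha>2 (f y) = \<alpha>1 y"
proof -
  have "f y \<in> X2" "y \<in> X1"
    using assms Y f_funcset by auto
  from \<pi>_eq_iff[OF InrI[OF this(1)] InlI[OF this(2)]] assms show ?thesis
    by (simp add: glue_inl_def glue_inr_def)
qed

lemma \<pi>_funcset: "\<pi> \<in> X1 <+> X2 \<rightarrow> G"
  by (auto intro: quotientI)

text \<open>Every point of \<open>X2\<close> has the form \<open>f y\<close>, hence is glued to a
  point of \<open>X1\<close>.\<close>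

lemma \<alpha>1_image: "\<alpha>1 ` X1 = G"
proof
  show "\<alpha>1 ` X1 \<subseteq> G"
    by (auto simp: glue_inl_def intro: quotientI)
  show "G \<subseteq> \<alpha>1 ` X1"
  proof
    fix c assume "c \<in> G"
    then obtain a where a: "a \<in> X1 <+> X2" "c = \<pi> a"
      by (rule quotientE)
    show "c \<in> \<alpha>1 ` X1"
    proof (cases a)
      case (Inl x)
      with a show ?thesis
        by (auto simp: glue_inl_def)
    next
      case (Inr z)
      with a have "z \<in> f ` Y" "c = \<alpha>2 z"
        using f_image by (auto simp: glue_inr_def)
      then show ?thesis
        using \<alpha>2_f Y by auto
    qed
  qed
qed

lemma sum_diff_diffeology: "diffeology_on (X1 <+> X2) (sum_diff X1 D1 X2 D2)"
proof -
  have "Inl \<in> X1 \<rightarrow> X1 <+> X2" "Inr \<in> X2 \<rightarrow> X1 <+> X2"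
    by auto
  then show ?thesis
    using diff_smooth_indiscrete[OF X1] diff_smooth_indiscrete[OF X2]
      diffeology_on_indiscrete[of "X1 <+> X2"]
    unfolding sum_diff_def by (intro diffeology_on_Inter) blast+
qed

lemma DG: "diffeology_on G DG"
  unfolding glue_diff_def quotient_diff_def
  by (rule diffeology_on_pushforward[OF sum_diff_diffeology \<pi>_funcset])

lemma \<pi>_plot: "(n, U, p) \<in> sum_diff X1 D1 X2 D2 \<Longrightarrow> (n, U, compose U \<pi> p) \<in> DG"
  unfolding glue_diff_def quotient_diff_def by (rule pushforward_plot)

lemma \<alpha>1_smooth: "diff_smooth X1 D1 G DG \<alpha>1"
proof (rule diff_smoothI)
  fix n U p assume "(n, U, p) \<in> D1"
  then have "(n, U, compose U Inl p) \<in> sum_diff X1 D1 X2 D2"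
    by (auto simp: sum_diff_def dest: diff_smoothD)
  from \<pi>_plot[OF this] show "(n, U, compose U \<alpha>1 p) \<in> DG"
    by (simp add: compose_def glue_inl_def cong: restrict_cong)
qed (use \<alpha>1_image in auto)

lemma \<alpha>2_smooth: "diff_smooth X2 D2 G DG \<alpha>2"
proof (rule diff_smoothI)
  show "\<alpha>2 \<in> X2 \<rightarrow> G"
    by (auto simp: glue_inr_def intro: quotientI)
  fix n U p assume "(n, U, p) \<in> D2"
  then have "(n, U, compose U Inr p) \<in> sum_diff X1 D1 X2 D2"
    by (auto simp: sum_diff_def dest: diff_smoothD)
  from \<pi>_plot[OF this] show "(n, U, compose U \<alpha>2 p) \<in> DG"
    by (simp add: compose_def glue_inr_def cong: restrict_cong)
qed

text \<open>Plots of \<open>X1 \<union>\<^sub>f X2\<close> coming from \<open>X2\<close> lift to \<open>Y\<close> because \<open>f\<close> is a subduction, so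
  \<open>X2\<close> contributes nothing new: the glued space is a quotient of \<open>X1\<close> alone.\<close>

lemma \<alpha>1_subduction: "subduction X1 D1 G DG \<alpha>1"
proof -
  \<comment> \<open>The maps that lift locally to \<open>X1\<close>. Once the projection is smooth
    into \<open>L\<close>, minimality of the quotient diffeology gives
    \<open>DG \<subseteq> L\<close>.\<close>
  define L where "L = lifted_diff D1 G \<alpha>1"
  have L: "diffeology_on G L"
    unfolding L_def by (rule diffeology_on_lifted_diff[OF X1 \<alpha>1_image])
  \<comment> \<open>The sum diffeology is minimal too: when both inclusions are smooth into this
    inverse image of \<open>L\<close>, it lies in \<open>E\<close>, so the projection is smooth into
    \<open>L\<close>.\<close>
  define E where "E = {(n, U, p). p \<in> U \<rightarrow>\<^sub>E X1 <+> X2 \<and> (n, U, compose U \<pi> p) \<in> L}"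
  have E: "diffeology_on (X1 <+> X2) E"
    unfolding E_def by (rule diffeology_on_vimage[OF L \<pi>_funcset])
  have "diff_smooth X1 D1 (X1 <+> X2) E Inl"
  proof (rule diff_smoothI)
    fix n U p assume p: "(n, U, p) \<in> D1"
    then have p': "domain n U" "p \<in> U \<rightarrow>\<^sub>E X1"
      using diffeology_on_domain[OF X1] diffeology_on_typed[OF X1] by auto
    have eq: "compose U \<pi> (compose U Inl p) = compose U \<alpha>1 p"
      by (simp add: compose_def glue_inl_def cong: restrict_cong)
    have "local_lift D1 \<alpha>1 n U (compose U \<alpha>1 p) u U p" if "u \<in> U" for u
      using p p'(1) that by (simp add: local_lift_def compose_def)
    moreover have "compose U \<alpha>1 p \<in> U \<rightarrow>\<^sub>E G"
      using p'(2) \<alpha>1_image by (auto simp: compose_def)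
    ultimately have "(n, U, compose U \<pi> (compose U Inl p)) \<in> L"
      unfolding L_def lifted_diff_def eq using p'(1) by blast
    then show "(n, U, compose U Inl p) \<in> E"
      using p'(2) unfolding E_def by (auto simp: compose_def)
  qed auto
  moreover have "diff_smooth X2 D2 (X1 <+> X2) E Inr"
  proof (rule diff_smoothI)
    fix n U p assume p: "(n, U, p) \<in> D2"
    then have p': "domain n U" "p \<in> U \<rightarrow>\<^sub>E X2"
      using diffeology_on_domain[OF X2] diffeology_on_typed[OF X2] by auto
    have eq: "compose U \<pi> (compose U Inr p) = compose U \<alpha>2 p"
      by (simp add: compose_def glue_inr_def cong: restrict_cong)
    have "\<exists>V q. local_lift D1 \<alpha>1 n U (compose U \<alpha>2 p) u V q" if "u \<in> U" for u
    proof -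
      \<comment> \<open>A lift through \<open>f\<close> into \<open>Y\<close> becomes a lift through
        \<open>\<alpha>1\<close>, because \<open>\<alpha>2 (f y) = \<alpha>1 y\<close>.\<close>
      obtain V q where q: "local_lift (sub_diff Y D1) f n U p u V q"
        using subduction_local_lift[OF f p \<open>u \<in> U\<close>] by blast
      then have V: "domain n V" "u \<in> V" "V \<subseteq> U" "(n, V, q) \<in> D1" "q ` V \<subseteq> Y"
        by (auto simp: local_lift_def sub_diff_def)
      have "restrict (compose U \<alpha>2 p) V x = compose V \<alpha>1 q x" for x
        using V(3,5) local_lift_eq[OF q, of x] \<alpha>2_f[of "q x"] by (auto simp: compose_def)
      with V show ?thesis
        unfolding local_lift_def by (intro exI[of _ V] exI[of _ q]) auto
    qed
    moreover have "compose U \<alpha>2 p \<in> U \<rightarrow>\<^sub>E G"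
      using p'(2) by (auto simp: compose_def glue_inr_def intro!: quotientI)
    ultimately have "(n, U, compose U \<pi> (compose U Inr p)) \<in> L"
      unfolding L_def lifted_diff_def eq using p'(1) by blast
    then show "(n, U, compose U Inr p) \<in> E"
      using p'(2) unfolding E_def by (auto simp: compose_def)
  qed auto
  ultimately have "sum_diff X1 D1 X2 D2 \<subseteq> E"
    using E unfolding sum_diff_def by blast
  then have "diff_smooth (X1 <+> X2) (sum_diff X1 D1 X2 D2) G L \<pi>"
    using \<pi>_funcset by (intro diff_smoothI) (auto simp: E_def)
  then have "DG \<subseteq> L"
    unfolding glue_diff_def quotient_diff_def by (rule pushforward_least[OF L])
  then have "\<exists>V q. local_lift D1 \<alpha>1 n U p u V q" if "(n, U, p) \<in> DG" "u \<in> U" for n U p u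
    using that unfolding L_def lifted_diff_def by blast
  then show ?thesis
    using \<alpha>1_smooth unfolding subduction_def local_lift_def by blast
qed

section \<open>Invariant forms and pushforwards on the glued space\<close>

text \<open>Distinct points of \<open>X1\<close> are identified by \<open>\<alpha>1\<close> exactly
  when both lie in \<open>Y\<close> and have the same value under \<open>f\<close>.\<close>

lemma inv_forms_eq_basic: "inv_forms m D1 Y f = basic_forms m D1 \<alpha>1"
  unfolding inv_forms_def by (rule forms_inv_wrt_cong[OF X1]) (auto simp: \<alpha>1_eq_iff)

text \<open>Pullback along \<open>\<alpha>1\<close> maps onto the basic forms and preserves plots,
  and \<open>descend\<close> lifts plots back; so basic forms on \<open>X1\<close> can replace forms
  on the glued space.\<close>

lemma pushforward_basic_forms:
  assumes "\<And>\<omega>. \<omega> \<in> forms m DG \<Longrightarrow> \<Phi> \<omega> = \<Psi> (form_pullback D1 \<alpha>1 \<omega>)"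
  shows "pushforward (forms m DG) (sub_diff (forms m DG) (form_diff m DG)) C \<Phi> =
    pushforward (basic_forms m D1 \<alpha>1) (sub_diff (basic_forms m D1 \<alpha>1) (form_diff m D1)) C \<Psi>"
proof (rule pushforward_comp_lift[where \<phi> = "form_pullback D1 \<alpha>1"])
  note desc = descend_in_forms[OF X1 DG \<alpha>1_subduction] form_pullback_descend[OF X1 \<alpha>1_smooth]
  note basic = form_pullback_in_basic_forms[OF X1 \<alpha>1_smooth]
  show "form_pullback D1 \<alpha>1 ` forms m DG = basic_forms m D1 \<alpha>1"
  proof
    show "basic_forms m D1 \<alpha>1 \<subseteq> form_pullback D1 \<alpha>1 ` forms m DG"
    proof
      fix \<omega> assume "\<omega> \<in> basic_forms m D1 \<alpha>1"
      from desc(2)[OF this, symmetric] desc(1)[OF this]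
      show "\<omega> \<in> form_pullback D1 \<alpha>1 ` forms m DG"
        by (rule image_eqI)
    qed
    show "form_pullback D1 \<alpha>1 ` forms m DG \<subseteq> basic_forms m D1 \<alpha>1"
      by (rule image_subsetI) (rule basic)
  qed
  show "P ` U \<subseteq> forms m DG \<and>
      (n, U, compose U (form_pullback D1 \<alpha>1) P) \<in> sub_diff (basic_forms m D1 \<alpha>1) (form_diff m D1)"
    if "(n, U, P) \<in> sub_diff (forms m DG) (form_diff m DG)" for n U P
    using that form_diff_pullback[OF X1 \<alpha>1_smooth, of n U P m] basic
    by (auto simp: sub_diff_def compose_def)
  show "\<exists>Q. (n, U, Q) \<in> sub_diff (forms m DG) (form_diff m DG) \<and>
      compose U (form_pullback D1 \<alpha>1) Q = P"
    if P0: "(n, U, P) \<in> sub_diff (basic_forms m D1 \<alpha>1) (form_diff m D1)" for n U P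
  proof (intro exI conjI)
    have P1: "(n, U, P) \<in> form_diff m D1"
      using P0 by (simp add: sub_diff_def)
    have P2: "P x \<in> basic_forms m D1 \<alpha>1" if "x \<in> U" for x
      using P0 that by (auto simp: sub_diff_def)
    show "(n, U, compose U (descend D1 DG \<alpha>1) P) \<in> sub_diff (forms m DG) (form_diff m DG)"
      using form_diff_descend[OF X1 DG \<alpha>1_subduction P1 P2] desc(1)[OF P2]
      by (auto simp: sub_diff_def compose_def)
    have "compose U (form_pullback D1 \<alpha>1) (compose U (descend D1 DG \<alpha>1) P) = restrict P U"
      unfolding compose_def using desc(2)[OF P2] by (intro restrict_ext) simp
    also have "\<dots> = P"
      using form_diff_plot(2)[OF P1] by (simp add: PiE_restrict)
    finally show "compose U (form_pullback D1 \<alpha>1) (compose U (descend D1 DG \<alpha>1) P) = P" .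
  qed
qed (rule assms)

lemma image_diff_glue_inl:
  assumes h: "diff_smooth W (sub_diff W D3) X1 D1 h"
  shows "image_diff m D3 W (\<alpha>1 \<circ> h) DG (forms m DG) = image_diff m D3 W h D1 (inv_forms m D1 Y f)"
  unfolding image_diff_eq[OF h] image_diff_eq[OF diff_smooth_comp[OF h \<alpha>1_smooth]]
    inv_forms_eq_basic
  by (rule pushforward_basic_forms) (simp add: form_pullback_comp[OF diff_smoothD[OF h]])

lemma inv_forms_glue_inl:
  assumes D3: "diffeology_on X3 D3" and h: "h \<in> W \<rightarrow> X1"
  shows "inv_forms m D3 W (\<alpha>1 \<circ> h) = inv_forms2 m D3 W h Y f"
  unfolding inv_forms_def inv_forms2_def
proof (rule forms_inv_wrt_cong[OF D3])
  fix x x'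
  have "\<alpha>1 (h x) = \<alpha>1 (h x') \<longleftrightarrow> h x = h x' \<or> h x \<in> Y \<and> h x' \<in> Y \<and> f (h x) = f (h x')"
    if "x \<in> W" "x' \<in> W"
    using that h by (intro \<alpha>1_eq_iff) auto
  then show "x \<in> W \<and> x' \<in> W \<and> (\<alpha>1 \<circ> h) x = (\<alpha>1 \<circ> h) x' \<longleftrightarrow> x \<in> W \<and> x' \<in> W \<and>
      (h x = h x' \<or> h x \<in> Y \<and> h x' \<in> Y \<and> f (h x) = f (h x'))"
    by auto
qed

text \<open>\<open>\<alpha>2\<close> is injective on \<open>X2\<close>, so composing with it leaves
  the equivalence of plots unchanged.\<close>

lemma inv_forms_glue_inr:
  assumes D3: "diffeology_on X3 D3" and h: "h \<in> W \<rightarrow> X2"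
  shows "inv_forms m D3 W (\<alpha>2 \<circ> h) = inv_forms m D3 W h"
  unfolding inv_forms_def
proof (rule forms_inv_wrt_cong[OF D3])
  fix x x'
  have "\<alpha>2 (h x) = \<alpha>2 (h x') \<longleftrightarrow> h x = h x'" if "x \<in> W" "x' \<in> W"
    using that h by (intro \<alpha>2_eq_iff) auto
  then show "x \<in> W \<and> x' \<in> W \<and> (\<alpha>2 \<circ> h) x = (\<alpha>2 \<circ> h) x' \<longleftrightarrow> x \<in> W \<and> x' \<in> W \<and> h x = h x'"
    by auto
qed

text \<open>One direction restricts families along \<open>\<alpha>2\<close>. In the other, a family
  on \<open>X2\<close> that is not locally constant must come locally from the glued space;
  \<open>push\<close> supplies a matching family of \<open>f\<close>-invariant forms on
  \<open>X1\<close>, which descends.\<close>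

lemma image_diff_glue_inr:
  assumes D3: "diffeology_on X3 D3" and W: "W \<subseteq> X3"
    and h: "diff_smooth W (sub_diff W D3) X2 D2 h"
    and push: "restriction_diff m D1 (inv_forms m D1 Y f) Y = image_diff m D1 Y f D2 (forms m D2)"
  shows "image_diff m D3 W (\<alpha>2 \<circ> h) DG (forms m DG) = image_diff m D3 W h D2 (forms m D2)"
  unfolding image_diff_eq[OF h] image_diff_eq[OF diff_smooth_comp[OF h \<alpha>2_smooth]]
proof (rule pushforward_cong)
  fix E assume E: "diffeology_on (forms m (sub_diff W D3)) E"
  have DW: "diffeology_on W (sub_diff W D3)"
    by (rule diffeology_on_sub_diff[OF D3 W])
  let ?h = "form_pullback (sub_diff W D3) h"
  let ?hbar = "form_pullback (sub_diff W D3) (\<alpha>2 \<circ> h)"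
  let ?f = "form_pullback (sub_diff Y D1) f"
  let ?i = "form_pullback (sub_diff Y D1) (\<lambda>x. x)"
  let ?a1 = "form_pullback D1 \<alpha>1"
  let ?a2 = "form_pullback D2 \<alpha>2"
  let ?d = "descend D1 DG \<alpha>1"
  have hbar: "?hbar \<omega> = ?h (?a2 \<omega>)" for \<omega>
    by (simp add: form_pullback_comp[OF diff_smoothD[OF h]])
  have h_forms: "?h \<in> forms m D2 \<rightarrow> forms m (sub_diff W D3)"
    using form_pullback_in_forms[OF DW h] by blast
  have a2_forms: "?a2 \<omega> \<in> forms m D2" if "\<omega> \<in> forms m DG" for \<omega>
    by (rule form_pullback_in_forms[OF X2 \<alpha>2_smooth that])
  have incl: "(n, U, compose U (\<lambda>x. x) p) \<in> D1" if "(n, U, p) \<in> sub_diff Y D1" for n U p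
  proof -
    have p: "(n, U, p) \<in> D1"
      using that by (simp add: sub_diff_def)
    have "compose U (\<lambda>x. x) p = p"
      using diffeology_on_typed[OF X1 p] by (simp add: compose_def PiE_restrict)
    with p show ?thesis
      by simp
  qed
  have incl_smooth: "diff_smooth Y (sub_diff Y D1) X1 D1 (\<lambda>x. x)"
    using Y incl by (intro diff_smoothI) auto
  \<comment> \<open>\<open>\<alpha>1\<close> and \<open>\<alpha>2 \<circ> f\<close> agree on
    \<open>Y\<close>, so the pullbacks of a form on the glued space to \<open>X1\<close> and
    \<open>X2\<close> match over \<open>Y\<close>.\<close>
  have compat: "?i (?a1 \<omega>) = ?f (?a2 \<omega>)" for \<omega>
  proof -
    have "?i (?a1 \<omega>) = form_pullback (sub_diff Y D1) (\<alpha>1 \<circ> (\<lambda>x. x)) \<omega>"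
      by (rule form_pullback_comp[OF incl])
    also have "\<dots> = form_pullback (sub_diff Y D1) (\<alpha>2 \<circ> f) \<omega>"
      using \<alpha>2_f by (intro fun_cong[OF form_pullback_cong[OF DY]]) simp
    also have "\<dots> = ?f (?a2 \<omega>)"
      by (rule form_pullback_comp[OF diff_smoothD[OF f_smooth], symmetric])
    finally show ?thesis .
  qed
  show "diff_smooth (forms m DG) (sub_diff (forms m DG) (form_diff m DG)) (forms m (sub_diff W D3)) E ?hbar
    \<longleftrightarrow> diff_smooth (forms m D2) (sub_diff (forms m D2) (form_diff m D2)) (forms m (sub_diff W D3)) E ?h"
    (is "?G \<longleftrightarrow> ?H")
  proof
    assume H: ?H
    show ?G
    proof (rule diff_smoothI)
      show "?hbar \<in> forms m DG \<rightarrow> forms m (sub_diff W D3)"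
        using h_forms a2_forms hbar by auto
      fix n U Q assume "(n, U, Q) \<in> sub_diff (forms m DG) (form_diff m DG)"
      then have "(n, U, compose U ?a2 Q) \<in> sub_diff (forms m D2) (form_diff m D2)"
        using form_diff_pullback[OF X2 \<alpha>2_smooth, of n U Q m] a2_forms
        by (auto simp: sub_diff_def compose_def)
      from diff_smoothD[OF H this] show "(n, U, compose U ?hbar Q) \<in> E"
        by (simp add: compose_def hbar cong: restrict_cong)
    qed
  next
    assume G: ?G
    show ?H
    proof (rule diff_smoothI[OF h_forms])
      fix n U Q assume Q: "(n, U, Q) \<in> sub_diff (forms m D2) (form_diff m D2)"
      show "(n, U, compose U ?h Q) \<in> E"
      \<comment> \<open>The roles: \<open>\<phi>\<close> is the pullback along \<open>f\<close>,
        \<open>\<theta>\<close> the restriction to \<open>Y\<close>, and \<open>\<psi>\<close> the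
        pullback along \<open>h\<close> whose smoothness is sought.\<close>
      proof (rule pushforward_transfer[OF E _ h_forms])
        show "inj_on ?f (forms m D2)"
          using form_pullback_inj[OF X2 f] by (intro inj_onI)
        show "?i \<in> basic_forms m D1 \<alpha>1 \<rightarrow> forms m (sub_diff Y D1)"
          using form_pullback_in_forms[OF DY incl_smooth] forms_inv_wrt_forms by blast
        show "domain n U" "Q \<in> U \<rightarrow> forms m D2"
          using Q form_diff_plot(1) by (auto simp: sub_diff_def)
        \<comment> \<open>The hypothesis on \<open>Y\<close> enters here: a plot pulled back along
          \<open>f\<close> is also a plot of the pushforward by restriction from
          \<open>X1\<close>.\<close>
        have "(n, U, compose U ?f Q) \<in> image_diff m D1 Y f D2 (forms m D2)"
          unfolding image_diff_eq[OF f_smooth] by (rule pushforward_plot[OF Q])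
        then show "(n, U, compose U ?f Q) \<in> pushforward (basic_forms m D1 \<alpha>1)
            (sub_diff (basic_forms m D1 \<alpha>1) (form_diff m D1)) (forms m (sub_diff Y D1)) ?i"
          unfolding push[symmetric] restriction_diff_def inv_forms_eq_basic .
        fix k V P assume "(k, V, P) \<in> sub_diff (basic_forms m D1 \<alpha>1) (form_diff m D1)"
        then have P: "(k, V, P) \<in> form_diff m D1" "\<And>v. v \<in> V \<Longrightarrow> P v \<in> basic_forms m D1 \<alpha>1"
          by (auto simp: sub_diff_def)
        have d: "?d (P v) \<in> forms m DG" "?a1 (?d (P v)) = P v" if "v \<in> V" for v
          using descend_in_forms[OF X1 DG \<alpha>1_subduction P(2)[OF that]]
            form_pullback_descend[OF X1 \<alpha>1_smooth P(2)[OF that]] by auto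
        \<comment> \<open>The family descends to the glued space, where \<open>G\<close> applies;
          its pullback along \<open>\<alpha>2\<close> is the witness \<open>r\<close>.\<close>
        have "(k, V, compose V ?d P) \<in> sub_diff (forms m DG) (form_diff m DG)"
          using form_diff_descend[OF X1 DG \<alpha>1_subduction P] d(1)
          by (auto simp: sub_diff_def compose_def)
        from diff_smoothD[OF G this] have E: "(k, V, compose V ?h (\<lambda>v. ?a2 (?d (P v)))) \<in> E"
          by (simp add: compose_def hbar cong: restrict_cong)
        have i: "\<forall>v\<in>V. ?i (P v) = ?f (?a2 (?d (P v)))"
          using compat d(2) by metis
        have r: "(\<lambda>v. ?a2 (?d (P v))) \<in> V \<rightarrow> forms m D2"
          by (rule Pi_I) (intro a2_forms d(1))
        show "domain k V \<and> P ` V \<subseteq> basic_forms m D1 \<alpha>1 \<and>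
            (\<exists>r\<in>V \<rightarrow> forms m D2. (\<forall>v\<in>V. ?i (P v) = ?f (r v)) \<and> (k, V, compose V ?h r) \<in> E)"
          by (intro conjI bexI[OF _ r] form_diff_plot(1)[OF P(1)] image_subsetI P(2) i E)
      qed
    qed
  qed
qed

end

theorem proposition2p53:
  fixes X1 :: "'a set" and D1 :: "'a plot set"
    and X2 :: "'b set" and D2 :: "'b plot set"
    and X3 :: "'c set" and D3 :: "'c plot set"
    and Y :: "'a set" and W1 W2 :: "'c set"
    and f :: "'a \<Rightarrow> 'b" and h1 :: "'c \<Rightarrow> 'a" and h2 :: "'c \<Rightarrow> 'b"
    and hbar1 hbar2 :: "'c \<Rightarrow> ('a + 'b) set"
    and m :: nat
  assumes "diffeology_on X1 D1" and "diffeology_on X2 D2" and "diffeology_on X3 D3"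
    and "Y \<subseteq> X1" and "W1 \<subseteq> X3" and "W2 \<subseteq> X3"
    and "subduction Y (sub_diff Y D1) X2 D2 f"
    and "diff_smooth W1 (sub_diff W1 D3) X1 D1 h1"
    and "diff_smooth W2 (sub_diff W2 D3) X2 D2 h2"
    and "hbar1 = glue_inl X1 X2 Y f \<circ> h1"
    and "hbar2 = glue_inr X1 X2 Y f \<circ> h2"
  shows
    "(restriction_diff m D1 (inv_forms m D1 Y f) Y = image_diff m D1 Y f D2 (forms m D2) \<and>
      restriction_diff m D3 (inv_forms2 m D3 W1 h1 Y f) W1
        = image_diff m D3 W1 h1 D1 (inv_forms m D1 Y f)
      \<longrightarrow>
      restriction_diff m D3 (inv_forms m D3 W1 hbar1) W1
        = image_diff m D3 W1 hbar1 (glue_diff X1 D1 X2 D2 Y f)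
            (forms m (glue_diff X1 D1 X2 D2 Y f)))
     \<and>
     (restriction_diff m D1 (inv_forms m D1 Y f) Y = image_diff m D1 Y f D2 (forms m D2) \<and>
      restriction_diff m D3 (inv_forms m D3 W2 h2) W2
        = image_diff m D3 W2 h2 D2 (forms m D2)
      \<longrightarrow>
      restriction_diff m D3 (inv_forms m D3 W2 hbar2) W2
        = image_diff m D3 W2 hbar2 (glue_diff X1 D1 X2 D2 Y f)
            (forms m (glue_diff X1 D1 X2 D2 Y f)))"
proof -
  interpret gluing X1 D1 X2 D2 Y f
    using assms(1,2,4,7) by unfold_locales
  have "h1 \<in> W1 \<rightarrow> X1" "h2 \<in> W2 \<rightarrow> X2"
    using assms(8,9) by (auto simp: diff_smooth_def)
  then show ?thesis
    \<comment> \<open>Rewriting turns each side of a conclusion into the corresponding side of its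
      hypothesis on \<open>W1\<close> or \<open>W2\<close>.\<close>
    using assms(3,5,6,8,9)
    by (auto simp: assms(10,11) inv_forms_glue_inl inv_forms_glue_inr
        image_diff_glue_inl image_diff_glue_inr)
qed

end
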